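(* Let $f_1,\dots,f_n:\mathbb{R}^d\to\mathbb{R}$ be twice continuously differentiable and let $\mu,L>0$ be constants such that $\mu I\preceq\nabla^2f_{\mathcal S}(x)\preceq LI$ for all $x\in\mathbb{R}^d$ and all nonempty $\mathcal S\subset[n]$. Let $h:\mathbb{R}^d\to\mathbb{R}\cup\{+\infty\}$ be proper, convex and lower semicontinuous, let $f=\frac1n\sum_{i=1}^nf_i$, $F=f+h$, let $x^*$ be the unique minimizer of $F$ and $F^*=F(x^* )$. Let $\{x_k\},\{B_k\}$ be generated by the generalized stochastic proximal quasi-Newton algorithm described in the context, with constant step size $\eta_k\equiv\eta$ and Hessian update frequency $r$, where the stochastic gradients $v_k$ are such that $\mathbb{E}_k[v_k]=\nabla f(x_k)$ for all $k\ge0$, and there exist constants $a,b,c\ge0$ and $\gamma\in(0,1]$ independent of $k$ and a sequence of random variables $\{\xi_k\}_{k\ge0}$ such that, for all $k\ge0$, $$\mathbb{E}_k\left[\|v_k-\nabla f(x_k)\|^2\right]\le a(F(x_k)-F^* )+b\,\xi_k,\qquad\mathbb{E}_k[\xi_{k+1}]\le(1-\gamma)\xi_k+c(F(x_k)-F^* ).$$ Suppose the constant $A>0$, the step size $\eta>0$ and the Hessian update frequency $r>0$ are chosen such that $$\rho:=\max\left\{1-\frac{\eta\mu}{m_2},\ \frac{2m_2b}{m_1^2A}+1-\gamma\right\}\in(0,1),\qquad\left(\frac{2m_2a}{m_1^2}+Ac\right)\eta\le2\rho,\qquad\left(\frac{m_2}{m_1}\right)^{\frac1r}\rho<1 ,$$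 where $m_1$ and $m_2$ are positive constants such that $m_1I\preceq B_k\preceq m_2I$ for all $k\ge0$. Define the Lyapunov function $V_k=\|x_k-x^*\|_{B_k}^2+A\eta^2\xi_k+2\eta[F(x_k)-F^*]$. Then for every $k\ge r$, $$\mathbb{E}[V_k]\le\left[\left(\frac{m_2}{m_1}\right)^{\frac1r}\rho\right]^k\left(\frac{m_2}{m_1}\rho^r\right)^{-1}V_0 .$$
   Context: Notation: $[n]=\{1,\dots,n\}$; $f_{\mathcal S}=\frac1{|\mathcal S|}\sum_{i\in\mathcal S}f_i$ for nonempty $\mathcal S\subset[n]$; $\|v\|$ is the Euclidean norm and $\|v\|_B=\sqrt{v^\top Bv}$ for $B$ positive definite; for symmetric matrices, $M\preceq N$ means $N-M$ is positive semidefinite. $\mathbb{E}$ is expectation over all randomness; $\mathbb{E}_k$ is expectation conditioned on the iterates $x_0,\dots,x_k$ and on the reference points (state) of the variance reduction method up to iteration $k$. Algorithm. Inputs: given initial point $x_0\in\mathbb{R}^d$ and initial reference points of the gradient estimator, step sizes $\eta_k>0$, positive integer $r$, positive integer memory size $l$. Initialize $t=0$, $\bar x^0=0$. For $k=0,1,2,\dots$: (1) If $k\ge r$ and $r$ divides $k$: set $t\leftarrow t+1$, $\bar x^t=\frac1r\sum_{j=k-r+1}^kx_j$, $s^t=\bar x^t-\bar x^{t-1}$; sample $\mathcal S^t\subset[n]$ (nonempty) and set $y^t=\nabla^2f_{\mathcal S^t}(\bar x^t)s^t$; add $(s^t,y^t)$ to the stored correction pairs, keeping only the latest $m\le l$ pairs,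 labelled $(s_j,y_j)=(s^{t-m+j},y^{t-m+j})$, $j=1,\dots,m$. The correction pairs used satisfy $s_j^\top y_j>0$. (2) Compute a (random) stochastic gradient $v_k$ by some variance reduction method, whose reference points are updated as that method prescribes. (3) Set $B_k=I$ if $k<r$, and $B_k=B^t$ (with the current $t$) if $k\ge r$; set $$x_{k+1}=\arg\min_{x\in\mathbb{R}^d}\left\{v_k^\top(x-x_k)+\frac1{2\eta_k}\|x-x_k\|_{B_k}^2+h(x)\right\}.$$ The L-BFGS matrix $B^t$ is $$B^t=\sigma_0I-\begin{bmatrix}\sigma_0S&Y\end{bmatrix}\begin{bmatrix}\sigma_0S^\top S&\mathcal L\\ \mathcal L^\top&-D\end{bmatrix}^{-1}\begin{bmatrix}\sigma_0S^\top\\ Y^\top\end{bmatrix},\qquad\sigma_0=\frac{y_m^\top y_m}{y_m^\top s_m},$$ with $S=[s_1,\dots,s_m]$, $Y=[y_1,\dots,y_m]\in\mathbb{R}^{d\times m}$, $D=\mathrm{diag}(s_1^\top y_1,\dots,s_m^\top y_m)$, and $\mathcal L\in\mathbb{R}^{m\times m}$ given by $\mathcal L_{ij}=s_i^\top y_j$ if $i>j$ and $0$ otherwise.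
   Formalization: Added: step size η ≤ m_1/L and ξ_k ≥ 0 almost surely (the claim is false without either); also, the Hessian samples S^t drawn so far do not change the conditional mean of v_k given the history (independent sampling), and ξ_0 is deterministic. *)

theory Defs
  imports "HOL-Probability.Probability" "Jordan_Normal_Form.Gauss_Jordan_Elimination"
begin

hide_const (open) Matrix.mat Matrix.vec

section \<open>Smooth and convex functions, matrix order\<close>

definition grad :: "(real^'d \<Rightarrow> real) \<Rightarrow> real^'d \<Rightarrow> real^'d" where
  "grad f x = (THE D. GDERIV f x :> D)"

definition hess :: "(real^'d \<Rightarrow> real) \<Rightarrow> real^'d \<Rightarrow> real^'d^'d" where
  "hess f x = matrix (frechet_derivative (grad f) (at x))"

definition twice_cont_differentiable :: "(real^'d \<Rightarrow> real) \<Rightarrow> bool" where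
  "twice_cont_differentiable f \<longleftrightarrow>
     (\<forall>x. f differentiable (at x)) \<and> (\<forall>x. grad f differentiable (at x)) \<and>
     continuous_on UNIV (hess f)"

definition subsample_avg :: "(nat \<Rightarrow> 'a \<Rightarrow> real) \<Rightarrow> nat set \<Rightarrow> 'a \<Rightarrow> real" where
  "subsample_avg f S x = (1 / real (card S)) * (\<Sum>i\<in>S. f i x)"

definition pos_semidef :: "real^'d^'d \<Rightarrow> bool" where
  "pos_semidef A \<longleftrightarrow> transpose A = A \<and> (\<forall>u. 0 \<le> inner u (A *v u))"

definition loewner_le :: "real^'d^'d \<Rightarrow> real^'d^'d \<Rightarrow> bool" (infix \<open>\<preceq>\<^sub>L\<close> 50) where
  "A \<preceq>\<^sub>L C \<longleftrightarrow> pos_semidef (C - A)"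

definition matrix_norm :: "real^'d^'d \<Rightarrow> real^'d \<Rightarrow> real" where
  "matrix_norm A u = sqrt (inner u (A *v u))"

text \<open>Functions into \<open>\<real> \<union> {+\<infinity>}\<close> are \<open>ereal\<close>-valued functions that avoid \<open>-\<infinity>\<close>.\<close>

definition proper_fun :: "('a \<Rightarrow> ereal) \<Rightarrow> bool" where
  "proper_fun h \<longleftrightarrow> (\<forall>x. h x \<noteq> -\<infinity>) \<and> (\<exists>x. h x \<noteq> \<infinity>)"

definition ereal_convex :: "('a::real_vector \<Rightarrow> ereal) \<Rightarrow> bool" where
  "ereal_convex h \<longleftrightarrow>
     (\<forall>x y. \<forall>u\<in>{0..1}. h ((1 - u) *\<^sub>R x + u *\<^sub>R y) \<le> ereal (1 - u) * h x + ereal u * h y)"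

definition lower_semicont :: "('a::topological_space \<Rightarrow> ereal) \<Rightarrow> bool" where
  "lower_semicont h \<longleftrightarrow> (\<forall>x. h x \<le> Liminf (at x) h)"

section \<open>The L-BFGS matrix\<close>

text \<open>
  \<open>lbfgs m s y\<close> is built from the pairs \<open>(s j, y j)\<close>, \<open>j = 1, \<dots>, m\<close>. Since \<open>m\<close> varies, the
  \<open>2m \<times> 2m\<close> middle matrix is a dimension-carrying matrix with indices starting at \<open>0\<close>, whence the
  shifts by one. \<open>W a\<close> is row \<open>a\<close> of the \<open>d \<times> 2m\<close> matrix \<open>[\<sigma>\<^sub>0 S, Y]\<close>. The middle matrix is
  invertible when all \<open>s\<^sub>j\<^sup>T y\<^sub>j\<close> are positive.
\<close>

definition lbfgs_middle ::
    "real \<Rightarrow> nat \<Rightarrow> (nat \<Rightarrow> real^'d) \<Rightarrow> (nat \<Rightarrow> real^'d) \<Rightarrow> real Matrix.mat" where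
  "lbfgs_middle \<sigma>\<^sub>0 m s y =
    (let SS = Matrix.mat m m (\<lambda>(i, j). inner (s (i + 1)) (s (j + 1)));
         LL = Matrix.mat m m (\<lambda>(i, j). if i > j then inner (s (i + 1)) (y (j + 1)) else 0);
         DD = Matrix.mat m m (\<lambda>(i, j). if i = j then inner (s (i + 1)) (y (i + 1)) else 0)
     in four_block_mat (\<sigma>\<^sub>0 \<cdot>\<^sub>m SS) LL (transpose_mat LL) (- DD))"

definition lbfgs :: "nat \<Rightarrow> (nat \<Rightarrow> real^'d) \<Rightarrow> (nat \<Rightarrow> real^'d) \<Rightarrow> real^'d^'d" where
  "lbfgs m s y =
    (let \<sigma>\<^sub>0 = inner (y m) (y m) / inner (y m) (s m);
         W = (\<lambda>a. Matrix.vec (2 * m)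
                (\<lambda>i. if i < m then \<sigma>\<^sub>0 * vec_nth (s (i + 1)) a else vec_nth (y (i - m + 1)) a));
         N = the (mat_inverse (lbfgs_middle \<sigma>\<^sub>0 m s y))
     in \<sigma>\<^sub>0 *\<^sub>R mat 1 - (\<chi> a b. scalar_prod (W a) (N *\<^sub>v W b)))"

section \<open>Metrics along one trajectory of the algorithm\<close>

text \<open>
  Here \<open>X\<close> is a trajectory of iterates, \<open>S t\<close> the \<open>t\<close>-th Hessian sample and \<open>mem t\<close> the number of
  pairs held after the \<open>t\<close>-th update. The \<open>t\<close>-th update takes place at iteration \<open>k = t r\<close>, so the
  counter has the value \<open>k div r\<close> once step (1) of iteration \<open>k\<close> is done.
\<close>

definition ref_avg :: "nat \<Rightarrow> (nat \<Rightarrow> real^'d) \<Rightarrow> nat \<Rightarrow> real^'d" where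
  "ref_avg r X t = (if t = 0 then 0 else (1 / real r) *\<^sub>R (\<Sum>j = t * r - r + 1..t * r. X j))"

definition corr_s :: "nat \<Rightarrow> (nat \<Rightarrow> real^'d) \<Rightarrow> nat \<Rightarrow> real^'d" where
  "corr_s r X t = ref_avg r X t - ref_avg r X (t - 1)"

definition corr_y ::
    "(nat \<Rightarrow> real^'d \<Rightarrow> real) \<Rightarrow> nat \<Rightarrow> (nat \<Rightarrow> real^'d) \<Rightarrow> (nat \<Rightarrow> nat set) \<Rightarrow> nat \<Rightarrow> real^'d" where
  "corr_y f r X S t = hess (subsample_avg f (S t)) (ref_avg r X t) *v corr_s r X t"

definition qn_metric ::
    "(nat \<Rightarrow> real^'d \<Rightarrow> real) \<Rightarrow> nat \<Rightarrow> (nat \<Rightarrow> nat) \<Rightarrow> (nat \<Rightarrow> real^'d) \<Rightarrow> (nat \<Rightarrow> nat set)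
      \<Rightarrow> nat \<Rightarrow> real^'d^'d" where
  "qn_metric f r mem X S k =
    (if k < r then mat 1
     else (let t = k div r; m = mem t in
       lbfgs m (\<lambda>j. corr_s r X (t - m + j)) (\<lambda>j. corr_y f r X S (t - m + j))))"

section \<open>Conditioning\<close>

definition vec_cond_exp :: "'w measure \<Rightarrow> 'w measure \<Rightarrow> ('w \<Rightarrow> real^'d) \<Rightarrow> 'w \<Rightarrow> real^'d" where
  "vec_cond_exp M G X \<omega> = (\<chi> i. real_cond_exp M G (\<lambda>\<omega>. vec_nth (X \<omega>) i) \<omega>)"

text \<open>
  \<open>history M P x \<phi> k\<close> is the \<open>\<sigma>\<close>-algebra generated by the iterates \<open>x 0, \<dots>, x k\<close> and the
  states \<open>\<phi> 0, \<dots>, \<phi> k\<close> of the gradient estimator (elements of the measurable space \<open>P\<close>);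
  \<open>\<E>\<^sub>k\<close> is conditioning on it. \<open>history_sub\<close> adds the Hessian samples \<open>S 1, \<dots>, S (k div r)\<close>
  drawn before the stochastic gradient of iteration \<open>k\<close>.
\<close>

definition history ::
    "'w measure \<Rightarrow> 'p measure \<Rightarrow> (nat \<Rightarrow> 'w \<Rightarrow> real^'d) \<Rightarrow> (nat \<Rightarrow> 'w \<Rightarrow> 'p) \<Rightarrow> nat \<Rightarrow> 'w measure" where
  "history M P x \<phi> k =
     vimage_algebra (space M) (\<lambda>\<omega>. \<lambda>i\<in>{..k}. (x i \<omega>, \<phi> i \<omega>)) (\<Pi>\<^sub>M i\<in>{..k}. borel \<Otimes>\<^sub>M P)"

definition history_sub ::
    "'w measure \<Rightarrow> 'p measure \<Rightarrow> nat \<Rightarrow> nat \<Rightarrow> (nat \<Rightarrow> 'w \<Rightarrow> real^'d) \<Rightarrow> (nat \<Rightarrow> 'w \<Rightarrow> 'p)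
      \<Rightarrow> (nat \<Rightarrow> 'w \<Rightarrow> nat set) \<Rightarrow> nat \<Rightarrow> 'w measure" where
  "history_sub M P n r x \<phi> S k =
     vimage_algebra (space M)
       (\<lambda>\<omega>. (\<lambda>i\<in>{..k}. (x i \<omega>, \<phi> i \<omega>), \<lambda>t\<in>{1..k div r}. S t \<omega>))
       ((\<Pi>\<^sub>M i\<in>{..k}. borel \<Otimes>\<^sub>M P) \<Otimes>\<^sub>M (\<Pi>\<^sub>M t\<in>{1..k div r}. count_space (Pow {1..n})))"

section \<open>The generalized stochastic proximal quasi-Newton algorithm\<close>

text \<open>
  The estimator is arbitrary: only its outputs \<open>v k\<close> and its states \<open>\<phi> k\<close> appear. The last
  assumption is what independent sampling of the \<open>S t\<close> and of the stochastic gradients provides: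
  given the history, knowing the Hessian samples does not change the mean of \<open>v k\<close>. It is needed
  because \<open>B k\<close> depends on these samples, which the iterates need not determine.
\<close>

locale stochastic_prox_quasi_newton = prob_space M
  for M :: "'w measure" +
  fixes P :: "'p measure"
    and n :: nat and f :: "nat \<Rightarrow> real^'d \<Rightarrow> real" and h :: "real^'d \<Rightarrow> ereal"
    and \<eta> :: "nat \<Rightarrow> real" and r l :: nat and mem :: "nat \<Rightarrow> nat"
    and x0 :: "real^'d" and \<phi>0 :: 'p
    and S :: "nat \<Rightarrow> 'w \<Rightarrow> nat set" and \<phi> :: "nat \<Rightarrow> 'w \<Rightarrow> 'p"
    and v x :: "nat \<Rightarrow> 'w \<Rightarrow> real^'d" and B :: "nat \<Rightarrow> 'w \<Rightarrow> real^'d^'d"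
  assumes step_size_pos: "\<And>k. 0 < \<eta> k"
    and r_pos: "0 < r" and l_pos: "0 < l"
    and memory: "\<And>t. 1 \<le> t \<Longrightarrow> 1 \<le> mem t \<and> mem t \<le> l \<and> mem t \<le> t"
    and measurable_sample: "\<And>t. 1 \<le> t \<Longrightarrow> S t \<in> measurable M (count_space (Pow {1..n}))"
    and measurable_state: "\<And>k. \<phi> k \<in> measurable M P"
    and measurable_gradient: "\<And>k. v k \<in> borel_measurable M"
    and measurable_iterate: "\<And>k. x k \<in> borel_measurable M"
    and initial_point: "\<And>\<omega>. \<omega> \<in> space M \<Longrightarrow> x 0 \<omega> = x0"
    and initial_state: "\<And>\<omega>. \<omega> \<in> space M \<Longrightarrow> \<phi> 0 \<omega> = \<phi>0"
    and sample_nonempty: "\<And>t \<omega>. 1 \<le> t \<Longrightarrow> \<omega> \<in> space M \<Longrightarrow> S t \<omega> \<noteq> {}"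
    and curvature: "AE \<omega> in M. \<forall>t\<ge>1.
        0 < inner (corr_s r (\<lambda>j. x j \<omega>) t) (corr_y f r (\<lambda>j. x j \<omega>) (\<lambda>j. S j \<omega>) t)"
    and metric: "\<And>k \<omega>. B k \<omega> = qn_metric f r mem (\<lambda>j. x j \<omega>) (\<lambda>j. S j \<omega>) k"
    and update: "AE \<omega> in M. \<forall>k. is_arg_min
        (\<lambda>z. ereal (inner (v k \<omega>) (z - x k \<omega>)
                    + 1 / (2 * \<eta> k) * (matrix_norm (B k \<omega>) (z - x k \<omega>))\<^sup>2) + h z)
        (\<lambda>_. True) (x (Suc k) \<omega>)"
    and sampling_independent: "\<And>k. AE \<omega> in M.
        vec_cond_exp M (history_sub M P n r x \<phi> S k) (v k) \<omega>
          = vec_cond_exp M (history M P x \<phi> k) (v k) \<omega>"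

end

theory Submission
  imports Defs "Jordan_Normal_Form.Determinant"
begin

text \<open>
  Write \<open>g = \<nabla>f\<close>, \<open>\<Delta> = v\<^sub>k - g(x\<^sub>k)\<close> and let \<open>q\<close> be the point that iteration \<open>k\<close> would produce from
  the exact gradient. Three ingredients give one step. The optimality condition of the proximal
  subproblem, strong convexity of \<open>f\<close> between \<open>x\<^sub>k\<close> and \<open>x\<^sup>*\<close> and the descent inequality between \<open>x\<^sub>k\<close>
  and \<open>x\<^sub>k\<^sub>+\<^sub>1\<close> (with \<open>\<eta>L \<le> m\<^sub>1\<close>) combine into
  \<open>\<parallel>x\<^sub>k\<^sub>+\<^sub>1 - x\<^sup>*\<parallel>\<^sup>2 + 2\<eta>(F(x\<^sub>k\<^sub>+\<^sub>1) - F\<^sup>*) \<le> (1 - \<eta>\<mu>/m\<^sub>2) \<parallel>x\<^sub>k - x\<^sup>*\<parallel>\<^sup>2 - 2\<eta>\<langle>\<Delta>, x\<^sub>k\<^sub>+\<^sub>1 - x\<^sup>*\<rangle>\<close>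
  in the norm of \<open>B\<^sub>k\<close> (\<open>prox_descent\<close>). The noise term is split at \<open>q\<close>: proximal steps are Lipschitz in
  the gradient, \<open>m\<^sub>1\<parallel>x\<^sub>k\<^sub>+\<^sub>1 - q\<parallel> \<le> \<eta>\<parallel>\<Delta>\<parallel>\<close> (\<open>prox_stability\<close>), so one part costs \<open>2\<eta>\<^sup>2\<parallel>\<Delta>\<parallel>\<^sup>2/m\<^sub>1\<close>, and the
  other part \<open>\<langle>\<Delta>, q - x\<^sup>*\<rangle>\<close> has mean zero because \<open>q\<close> is a function of the past (\<open>expectation_inner_noise\<close>).
  With the variance bound and the recursion for \<open>\<xi>\<^sub>k\<close>, the choice of \<open>\<rho>\<close> makes the Lyapunov function
  contract by \<open>\<rho>\<close> as long as the metric is kept (\<open>lyapunov_contraction\<close>).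

  The metric changes only when \<open>r\<close> divides the iteration number, and a change inflates squared distances
  by at most \<open>m\<^sub>2/m\<^sub>1\<close>. Hence \<open>\<E>[V\<^sub>k]\<close> is at most \<open>(m\<^sub>2/m\<^sub>1)\<close> to the power \<open>\<lfloor>k/r\<rfloor>\<close>, times \<open>\<rho>\<^sup>k V\<^sub>0\<close>, which
  is below the claimed bound because \<open>(m\<^sub>2/m\<^sub>1) \<rho>\<^sup>r < 1\<close> (\<open>geometric_rate_bound\<close>).

  Two points need care. First, \<open>q\<close> must be measurable with respect to the history together with the Hessian
  samples. The minimiser depends continuously on the metric, the centre and the gradient
  (\<open>continuous_on_prox_step\<close>), and \<open>B\<^sub>k\<close> is a Borel function of the iterates and samples, since the inverse
  in the L-BFGS formula is a rational function of its entries wherever it exists (\<open>borel_measurable_lbfgs\<close>).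
  Second, a conditional expectation of a non-integrable function carries no information, so the
  integrability of the three terms of \<open>V\<^sub>k\<close>, and with it the square integrability of iterates and gradients,
  is carried through the induction along with the estimate. The recursion is run with total expectations. The case \<open>F(x\<^sub>0) = \<infinity>\<close> is trivial, and from the first step
  on all values of \<open>F\<close> are almost surely finite.
\<close>

hide_const (open) Matrix.mat Matrix.vec

section \<open>Gradients, Hessians and quadratic bounds\<close>

lemma has_gradient:
  fixes f :: "real^'d \<Rightarrow> real"
  assumes "f differentiable (at x)"
  shows "GDERIV f x :> grad f x"
proof -
  obtain f' where f': "(f has_derivative f') (at x)"
    using assms unfolding differentiable_def by blast
  then have lin: "linear f'" by (rule has_derivative_linear)
  have "GDERIV f x :> (\<Sum>b\<in>Basis. f' b *\<^sub>R b)"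
  proof -
    have "f' u = inner u (\<Sum>b\<in>Basis. f' b *\<^sub>R b)" for u
    proof -
      have "f' u = f' (\<Sum>b\<in>Basis. inner u b *\<^sub>R b)" by (simp add: euclidean_representation)
      also have "\<dots> = (\<Sum>b\<in>Basis. inner u b *\<^sub>R f' b)"
        by (simp add: linear_sum[OF lin] linear_cmul[OF lin])
      finally show ?thesis by (simp add: inner_sum_right mult.commute)
    qed
    then have "f' = (\<lambda>u. inner u (\<Sum>b\<in>Basis. f' b *\<^sub>R b))" by (rule ext)
    then show ?thesis using f' unfolding gderiv_def by simp
  qed
  moreover have "D = E" if "GDERIV f x :> D" "GDERIV f x :> E" for D E
  proof -
    have "(\<lambda>u. inner u D) = (\<lambda>u. inner u E)"
      using that unfolding gderiv_def by (rule has_derivative_unique)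
    then have "inner u D = inner u E" for u by (rule fun_cong)
    then show ?thesis using iffD1[OF vector_eq_ldot] by blast
  qed
  ultimately show ?thesis unfolding grad_def by (metis (mono_tags, lifting) theI')
qed

lemma grad_eqI:
  assumes "GDERIV f x :> D"
  shows "grad f x = D"
proof -
  have "GDERIV f x :> grad f x"
    using assms unfolding gderiv_def by (intro has_gradient[unfolded gderiv_def] differentiableI)
  then have "(\<lambda>u. inner u (grad f x)) = (\<lambda>u. inner u D)"
    using assms unfolding gderiv_def by (rule has_derivative_unique)
  then have "inner u (grad f x) = inner u D" for u by (rule fun_cong)
  then show ?thesis using iffD1[OF vector_eq_ldot] by blast
qed

lemma hess_has_derivative:
  assumes "grad f differentiable (at x)"
  shows "(grad f has_derivative (\<lambda>d. hess f x *v d)) (at x)"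
proof -
  have d: "(grad f has_derivative frechet_derivative (grad f) (at x)) (at x)"
    using assms frechet_derivative_works by blast
  show ?thesis
    unfolding hess_def using d matrix_vector_mul(2)[OF has_derivative_linear[OF d]] by simp
qed

lemma hess_eqI:
  assumes "(grad f has_derivative (\<lambda>d. H *v d)) (at x)"
  shows "hess f x = H"
  unfolding hess_def frechet_derivative_at[OF assms, symmetric]
  by (rule matrix_of_matrix_vector_mul)

lemma sum_matrix_vector_mult:
  "(\<Sum>i\<in>T. A i) *v u = (\<Sum>i\<in>T. (A i :: real^'d^'d) *v u)"
  by (induction T rule: infinite_finite_induct)
    (simp_all add: matrix_vector_mult_add_rdistrib)

lemma twice_cont_differentiable_subsample_avg:
  fixes f :: "nat \<Rightarrow> real^'d \<Rightarrow> real"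
  assumes "\<And>i. i \<in> T \<Longrightarrow> twice_cont_differentiable (f i)"
  shows "twice_cont_differentiable (subsample_avg f T)"
proof -
  let ?w = "1 / real (card T)"
  have g: "GDERIV (subsample_avg f T) x :> ?w *\<^sub>R (\<Sum>i\<in>T. grad (f i) x)" for x
  proof -
    have "((\<lambda>x. ?w * (\<Sum>i\<in>T. f i x)) has_derivative
      (\<lambda>u. ?w * (\<Sum>i\<in>T. inner u (grad (f i) x)))) (at x)"
      using assms unfolding twice_cont_differentiable_def
      by (intro has_derivative_mult_right has_derivative_sum has_gradient[unfolded gderiv_def]) auto
    then show ?thesis unfolding gderiv_def
      by (simp add: subsample_avg_def[abs_def] inner_sum_right)
  qed
  then have G: "grad (subsample_avg f T) = (\<lambda>x. ?w *\<^sub>R (\<Sum>i\<in>T. grad (f i) x))"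
    by (intro ext grad_eqI)
  let ?H = "\<lambda>x. ?w *\<^sub>R (\<Sum>i\<in>T. hess (f i) x)"
  have h: "(grad (subsample_avg f T) has_derivative (\<lambda>d. ?H x *v d)) (at x)" for x
  proof -
    have "((\<lambda>x. ?w *\<^sub>R (\<Sum>i\<in>T. grad (f i) x)) has_derivative
      (\<lambda>d. ?w *\<^sub>R (\<Sum>i\<in>T. hess (f i) x *v d))) (at x)"
      using assms unfolding twice_cont_differentiable_def
      by (intro has_derivative_scaleR_right has_derivative_sum hess_has_derivative) auto
    then show ?thesis
      unfolding G by (simp add: sum_matrix_vector_mult flip: scaleR_matrix_vector_assoc)
  qed
  have "hess (subsample_avg f T) = ?H"
    using hess_eqI[OF h] by blast
  moreover have "continuous_on UNIV ?H"
    using assms unfolding twice_cont_differentiable_def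
    by (intro continuous_intros) auto
  ultimately show ?thesis
    unfolding twice_cont_differentiable_def using g h
    by (auto simp: gderiv_def differentiable_def)
qed

lemma loewner_leD:
  assumes "\<mu> *\<^sub>R mat 1 \<preceq>\<^sub>L H" "H \<preceq>\<^sub>L L *\<^sub>R mat 1"
  shows "\<mu> * (norm u)\<^sup>2 \<le> inner u (H *v u)" "inner u (H *v u) \<le> L * (norm u)\<^sup>2"
    "transpose H = H"
proof -
  show "\<mu> * (norm u)\<^sup>2 \<le> inner u (H *v u)" "inner u (H *v u) \<le> L * (norm u)\<^sup>2"
    using assms unfolding loewner_le_def pos_semidef_def
    by (auto simp: matrix_vector_mult_diff_rdistrib inner_diff_right power2_norm_eq_inner
        simp flip: scaleR_matrix_vector_assoc)
  have "transpose (H - \<mu> *\<^sub>R mat 1) = H - \<mu> *\<^sub>R mat 1"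
    using assms unfolding loewner_le_def pos_semidef_def by blast
  moreover have "transpose H = transpose (H - \<mu> *\<^sub>R mat 1) + \<mu> *\<^sub>R mat 1"
    by (auto simp: Finite_Cartesian_Product.vec_eq_iff transpose_def
        Finite_Cartesian_Product.mat_def)
  ultimately show "transpose H = H" by simp
qed

lemma symmetric_inner:
  fixes H :: "real^'d^'d"
  assumes "transpose H = H"
  shows "inner (H *v u) w = inner u (H *v w)"
  by (metis assms dot_lmul_matrix vector_transpose_matrix)

text \<open>
  Taylor's formula of order two on the segment from \<open>x\<close> to \<open>y\<close>: one intermediate point gives both the
  strong convexity bound and the descent bound.
\<close>

lemma quadratic_bounds:
  fixes g :: "real^'d \<Rightarrow> real"
  assumes g: "twice_cont_differentiable g"
    and H: "\<And>z. \<mu> *\<^sub>R mat 1 \<preceq>\<^sub>L hess g z" "\<And>z. hess g z \<preceq>\<^sub>L L *\<^sub>R mat 1"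
  shows "g x + inner (grad g x) (y - x) + \<mu> / 2 * (norm (y - x))\<^sup>2 \<le> g y"
    and "g y \<le> g x + inner (grad g x) (y - x) + L / 2 * (norm (y - x))\<^sup>2"
proof -
  define d where "d = y - x"
  define D where "D m t = (if m = 0 then g (x + t *\<^sub>R d)
     else if m = 1 then inner (grad g (x + t *\<^sub>R d)) d
     else inner (hess g (x + t *\<^sub>R d) *v d) d)" for m :: nat and t :: real
  have line: "((\<lambda>t. x + t *\<^sub>R d) has_derivative (\<lambda>s. s *\<^sub>R d)) (at t)" for t
    by (auto intro!: derivative_eq_intros)
  have D0: "(D 0 has_real_derivative D 1 t) (at t)" for t
  proof -
    have "(g has_derivative (\<lambda>u. inner u (grad g (x + t *\<^sub>R d)))) (at (x + t *\<^sub>R d))"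
      using g has_gradient unfolding twice_cont_differentiable_def gderiv_def by blast
    from diff_chain_at[OF line this] show ?thesis
      by (simp add: D_def[abs_def] has_field_derivative_def o_def inner_commute
          mult.commute[of _ "inner d _"])
  qed
  have D1: "(D 1 has_real_derivative D 2 t) (at t)" for t
  proof -
    have "(grad g has_derivative (\<lambda>u. hess g (x + t *\<^sub>R d) *v u)) (at (x + t *\<^sub>R d))"
      using g hess_has_derivative unfolding twice_cont_differentiable_def by blast
    from has_derivative_inner_left[OF diff_chain_at[OF line this], of d] show ?thesis
      by (simp add: D_def[abs_def] has_field_derivative_def o_def matrix_vector_mult_scaleR
          mult.commute[of _ "inner _ d"])
  qed
  have "\<exists>t>0. t < 1 \<and> g y = (\<Sum>m<2. D m 0 / fact m * (1 - 0) ^ m) + D 2 t / fact 2 * (1 - 0) ^ 2"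
  proof -
    have "\<exists>t>0. t < 1 \<and> D 0 1 = (\<Sum>m<2. D m 0 / fact m * (1 - 0) ^ m) + D 2 t / fact 2 * (1 - 0) ^ 2"
      using D0 D1 by (intro Taylor_up[of 2 D "D 0" 0 1 0]) (auto simp: less_Suc_eq numeral_2_eq_2)
    then show ?thesis by (simp add: D_def d_def)
  qed
  then obtain t where "g y = g x + inner (grad g x) d + inner (hess g (x + t *\<^sub>R d) *v d) d / 2"
    by (auto simp: D_def numeral_2_eq_2)
  with loewner_leD(1,2)[OF H, of d "x + t *\<^sub>R d"]
  show "g x + inner (grad g x) (y - x) + \<mu> / 2 * (norm (y - x))\<^sup>2 \<le> g y"
    and "g y \<le> g x + inner (grad g x) (y - x) + L / 2 * (norm (y - x))\<^sup>2"
    by (auto simp: d_def inner_commute)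
qed

text \<open>
  Comparing the linear minorant at \<open>y\<close> with the quadratic majorant at \<open>x\<close> bounds the square of the gradient
  difference by the Bregman distance (co-coercivity). This turns square integrability of the distance to
  the minimiser into square integrability of the gradients.
\<close>

lemma gradient_lipschitz:
  fixes g :: "'a::real_inner \<Rightarrow> real"
  assumes "0 < L"
    and lower: "\<And>x y. g x + inner (G x) (y - x) \<le> g y"
    and upper: "\<And>x y. g y \<le> g x + inner (G x) (y - x) + L / 2 * (norm (y - x))\<^sup>2"
  shows "norm (G x - G y) \<le> L * norm (x - y)"
proof -
  define e where "e = G x - G y"
  \<comment> \<open>\<open>w\<close> minimises the majorant at \<open>x\<close> minus the linear minorant at \<open>y\<close>.\<close>
  define w where "w = x - (1 / L) *\<^sub>R e"
  have "g y + inner (G y) (w - y) \<le> g x + inner (G x) (w - x) + L / 2 * (norm (w - x))\<^sup>2"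
    using lower[of y w] upper[of w x] by linarith
  moreover have "inner (G y) (w - y) - inner (G x) (w - x) = inner (G y) (x - y) + inner e e / L"
    unfolding w_def e_def by (simp add: algebra_simps inner_diff_left inner_diff_right
      diff_divide_distrib add_divide_distrib)
  moreover have "L / 2 * (norm (w - x))\<^sup>2 = inner e e / L / 2"
    using \<open>0 < L\<close> unfolding w_def
    by (simp add: power2_norm_eq_inner[symmetric] power_divide power2_eq_square)
  ultimately have "inner e e / L / 2 \<le> g x - g y - inner (G y) (x - y)"
    by linarith
  also have "\<dots> \<le> L / 2 * (norm (x - y))\<^sup>2" using upper[of x y] by linarith
  finally have "(norm e)\<^sup>2 \<le> (L * norm (x - y))\<^sup>2"
    using \<open>0 < L\<close> by (simp add: power2_norm_eq_inner[symmetric] field_simps power2_eq_square)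
  then have "norm e \<le> L * norm (x - y)"
    by (rule power2_le_imp_le) (use \<open>0 < L\<close> in simp)
  then show ?thesis by (simp only: e_def)
qed

section \<open>Proximal steps in a variable metric\<close>

lemma nonneg_of_small_perturbation:
  fixes a c :: real
  assumes "\<And>t. 0 < t \<Longrightarrow> t \<le> 1 \<Longrightarrow> 0 \<le> a + t * c"
  shows "0 \<le> a"
proof (rule ccontr)
  assume "\<not> 0 \<le> a"
  \<comment> \<open>For this \<open>t\<close> the perturbation is at most \<open>- a / 2\<close>, which cannot compensate \<open>a\<close>.\<close>
  define t where "t = min 1 (- a / (2 * (\<bar>c\<bar> + 1)))"
  have t: "0 < t" "t \<le> 1" using \<open>\<not> 0 \<le> a\<close> by (auto simp: t_def divide_simps)
  have half: "- a / (2 * q) * q = - a / 2" if "0 < q" for q :: real using that by simp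
  have "t * (\<bar>c\<bar> + 1) \<le> - a / (2 * (\<bar>c\<bar> + 1)) * (\<bar>c\<bar> + 1)"
    by (rule mult_right_mono) (auto simp: t_def)
  also have "\<dots> = - a / 2" by (rule half) simp
  finally have "t * (\<bar>c\<bar> + 1) \<le> - a / 2" .
  moreover have "t * c \<le> t * (\<bar>c\<bar> + 1)" using t by (intro mult_left_mono) auto
  ultimately show False using assms[OF t] \<open>\<not> 0 \<le> a\<close> by linarith
qed

text \<open>
  The first-order condition for minimising a smooth plus a convex function: moving from the minimiser \<open>p\<close>
  towards \<open>z\<close> by a fraction \<open>t\<close>, convexity makes the change of \<open>h\<close> at most \<open>t (h z - h p)\<close>; divide by \<open>t\<close>
  and let it tend to \<open>0\<close>. The smooth part is described by a quadratic upper estimate at \<open>p\<close>, which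
  covers both the proximal subproblem and the minimisation of \<open>F\<close> itself.
\<close>

lemma variational_inequality:
  fixes h :: "'a::real_inner \<Rightarrow> ereal" and \<phi> :: "'a \<Rightarrow> real"
  assumes h: "proper_fun h" "ereal_convex h"
    and min: "is_arg_min (\<lambda>z. ereal (\<phi> z) + h z) (\<lambda>_. True) p"
    and smooth: "\<And>d t. 0 < t \<Longrightarrow> t \<le> 1 \<Longrightarrow> \<phi> (p + t *\<^sub>R d) \<le> \<phi> p + t * inner G d + t\<^sup>2 * C d"
  shows "h p \<noteq> \<infinity>" and "h p \<le> h z + ereal (inner G (z - p))"
proof -
  have le: "ereal (\<phi> p) + h p \<le> ereal (\<phi> z) + h z" for z
    using min unfolding is_arg_min_def by (auto simp: not_less)
  obtain z0 where "h z0 \<noteq> \<infinity>" using h(1) unfolding proper_fun_def by blast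
  with le[of z0] show fin: "h p \<noteq> \<infinity>" by auto
  have ninf: "h u \<noteq> -\<infinity>" for u using h(1) unfolding proper_fun_def by blast
  show "h p \<le> h z + ereal (inner G (z - p))"
  proof (cases "h z = \<infinity>")
    case False
    obtain hp hz where hp: "h p = ereal hp" and hz: "h z = ereal hz"
      using fin False ninf by (metis ereal_cases)
    let ?d = "z - p"
    have "0 \<le> (inner G ?d + hz - hp) + t * C ?d" if t: "0 < t" "t \<le> 1" for t
    proof -
      have w: "(1 - t) *\<^sub>R p + t *\<^sub>R z = p + t *\<^sub>R ?d" by (simp add: algebra_simps)
      have "h (p + t *\<^sub>R ?d) \<le> ereal (1 - t) * h p + ereal t * h z"
        using h(2) t unfolding ereal_convex_def w[symmetric] by auto
      then have "h (p + t *\<^sub>R ?d) \<le> ereal ((1 - t) * hp + t * hz)" by (simp add: hp hz)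
      then have "ereal (\<phi> p) + h p \<le> ereal (\<phi> (p + t *\<^sub>R ?d)) + ereal ((1 - t) * hp + t * hz)"
        using le[of "p + t *\<^sub>R ?d"] by (meson add_left_mono order_trans)
      then have "\<phi> p + hp \<le> \<phi> (p + t *\<^sub>R ?d) + ((1 - t) * hp + t * hz)" by (simp add: hp)
      with smooth[OF t, of ?d]
      have "0 \<le> t * inner G ?d + t\<^sup>2 * C ?d - t * hp + t * hz" by (simp add: algebra_simps)
      then have "0 \<le> t * ((inner G ?d + hz - hp) + t * C ?d)"
        by (simp add: algebra_simps power2_eq_square)
      then show ?thesis using t by (simp add: zero_le_mult_iff)
    qed
    then have "0 \<le> inner G ?d + hz - hp" by (rule nonneg_of_small_perturbation)
    then show ?thesis by (simp add: hp hz)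
  qed simp
qed

text \<open>
  The bound \<open>\<psi>\<close> is allowed to vary so that sublevel sets of \<open>\<psi> + h\<close> are covered as well as those of \<open>h\<close>.
\<close>

lemma lower_semicont_closed:
  fixes h :: "'a::metric_space \<Rightarrow> ereal"
  assumes "lower_semicont h" and \<psi>: "continuous_on UNIV \<psi>"
  shows "closed {z. h z \<le> ereal (\<psi> z)}"
proof -
  have "open {z. ereal (\<psi> z) < h z}"
  proof (subst open_subopen, intro ballI)
    fix z assume "z \<in> {z. ereal (\<psi> z) < h z}"
    then obtain y where y: "ereal (\<psi> z) < ereal y" "ereal y < h z"
      using ereal_dense2 by blast
    then have "ereal y < Liminf (at z) h"
      using assms(1) unfolding lower_semicont_def by (meson less_le_trans)
    then have "\<forall>\<^sub>F u in at z. ereal y < h u" by (rule less_LiminfD)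
    moreover have "\<forall>\<^sub>F u in at z. \<psi> u < y"
      using \<psi> y(1) by (intro order_tendstoD(2)[of \<psi> "\<psi> z"])
        (auto simp: continuous_on_def)
    ultimately have "\<forall>\<^sub>F u in at z. ereal (\<psi> u) < h u"
      by eventually_elim (meson ereal_less(2) less_ereal.simps(1) less_trans)
    moreover have "ereal (\<psi> z) < h z" using y by (rule less_trans)
    ultimately have "\<forall>\<^sub>F u in nhds z. ereal (\<psi> u) < h u"
      by (auto simp: eventually_at_filter elim: eventually_mono)
    then show "\<exists>T. open T \<and> z \<in> T \<and> T \<subseteq> {z. ereal (\<psi> z) < h z}"
      by (auto simp: eventually_nhds)
  qed
  then show ?thesis unfolding closed_def by (simp add: Collect_neg_eq[symmetric] not_le)
qed

lemma borel_measurable_lower_semicont: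
  fixes h :: "'a::metric_space \<Rightarrow> ereal"
  assumes "lower_semicont h"
  shows "h \<in> borel_measurable borel"
proof (rule borel_measurableI_le)
  fix y
  show "{x \<in> space borel. h x \<le> y} \<in> sets borel"
  proof (cases y)
    case (real c)
    then show ?thesis using lower_semicont_closed[OF assms, of "\<lambda>_. c"] by (simp add: borel_closed)
  next
    case PInf
    then show ?thesis by simp
  next
    case MInf
    have "{x. h x \<le> y} = (\<Inter>c::nat. {x. h x \<le> ereal (- real c)})"
    proof (rule Set.set_eqI, rule iffI)
      fix x assume *: "x \<in> (\<Inter>c::nat. {x. h x \<le> ereal (- real c)})"
      have "h x \<le> ereal b" for b
      proof -
        obtain c :: nat where "- b \<le> real c" using real_arch_simple by blast
        then have "ereal (- real c) \<le> ereal b" by simp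
        then show ?thesis using * by (auto intro: order_trans)
      qed
      then show "x \<in> {x. h x \<le> y}" using MInf ereal_bot by simp
    qed (use MInf in auto)
    moreover have "closed (\<Inter>c::nat. {x. h x \<le> ereal (- real c)})"
      using lower_semicont_closed[OF assms, of "\<lambda>_. - real _"] by (intro closed_INT) auto
    ultimately show ?thesis by (simp add: borel_closed)
  qed
qed

lemma quadratic_sublevel_bounded:
  fixes N C M u :: real
  assumes "0 < M" "0 \<le> N" "0 \<le> u" "M * u\<^sup>2 \<le> C + N * u"
  shows "u \<le> 1 + (\<bar>C\<bar> + N) / M"
proof (cases "u \<le> 1")
  case True
  then show ?thesis using assms by (smt (verit) divide_nonneg_pos)
next
  case False
  have "M * u * u \<le> \<bar>C\<bar> * u + N * u"
    using assms(4) False by (smt (verit) mult_left_le_one_le mult_le_cancel_left1 power2_eq_square mult.assoc)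
  then have "M * u \<le> \<bar>C\<bar> + N"
    using False by (metis assms(3) distrib_right linorder_not_le mult_right_le_imp_le order_le_less zero_le_one)
  then show ?thesis using assms(1) by (smt (verit) le_divide_eq mult.commute)
qed

text \<open>
  \<open>prox_step \<eta> h B x g\<close> is the scaled proximal map of \<open>h\<close> at \<open>x - \<eta> B\<^sup>-\<^sup>1 g\<close>; the form below avoids the inverse.
\<close>

definition prox_objective ::
    "real \<Rightarrow> (real^'d \<Rightarrow> ereal) \<Rightarrow> real^'d^'d \<Rightarrow> real^'d \<Rightarrow> real^'d \<Rightarrow> real^'d \<Rightarrow> ereal" where
  "prox_objective \<eta> h B x g z =
     ereal (inner g (z - x) + 1 / (2 * \<eta>) * (matrix_norm B (z - x))\<^sup>2) + h z"

definition prox_step ::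
    "real \<Rightarrow> (real^'d \<Rightarrow> ereal) \<Rightarrow> real^'d^'d \<Rightarrow> real^'d \<Rightarrow> real^'d \<Rightarrow> real^'d" where
  "prox_step \<eta> h B x g = (SOME p. is_arg_min (prox_objective \<eta> h B x g) (\<lambda>_. True) p)"

lemma matrix_norm_sq:
  fixes B :: "real^'d^'d"
  assumes "m1 *\<^sub>R mat 1 \<preceq>\<^sub>L B" "B \<preceq>\<^sub>L m2 *\<^sub>R mat 1" "0 \<le> m1"
  shows "(matrix_norm B u)\<^sup>2 = inner u (B *v u)"
  using loewner_leD(1)[OF assms(1,2), of u] assms(3)
  unfolding matrix_norm_def by (smt (verit) mult_nonneg_nonneg real_sqrt_pow2 zero_le_power2)

text \<open>
  An affine minorant of \<open>h\<close> is dominated by the strongly convex quadratic, so the sublevel sets of the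
  objective are compact, and the nonempty ones have a common point.
\<close>

lemma prox_step_exists:
  fixes h :: "real^'d \<Rightarrow> ereal" and B :: "real^'d^'d"
  assumes h: "proper_fun h" "lower_semicont h"
    and minorant: "\<And>z. ereal (\<alpha> + inner \<beta> z) \<le> h z"
    and B: "m1 *\<^sub>R mat 1 \<preceq>\<^sub>L B" "B \<preceq>\<^sub>L m2 *\<^sub>R mat 1" and pos: "0 < m1" "0 < \<eta>"
  shows "is_arg_min (prox_objective \<eta> h B x g) (\<lambda>_. True) (prox_step \<eta> h B x g)"
proof -
  define \<phi> where "\<phi> z = inner g (z - x) + 1 / (2 * \<eta>) * inner (z - x) (B *v (z - x))" for z
  let ?J = "prox_objective \<eta> h B x g"
  have J: "?J z = ereal (\<phi> z) + h z" for z
    unfolding prox_objective_def \<phi>_def using matrix_norm_sq[OF B] pos by simp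
  define K where "K c = {z. ?J z \<le> ereal c}" for c
  have K: "K c = {z. h z \<le> ereal (c - \<phi> z)}" for c
    unfolding K_def J
  proof (intro Collect_cong)
    fix z show "(ereal (\<phi> z) + h z \<le> ereal c) = (h z \<le> ereal (c - \<phi> z))"
      by (cases "h z") auto
  qed
  have "continuous_on UNIV \<phi>" unfolding \<phi>_def
    by (intro continuous_intros matrix_vector_mult_linear_continuous_on[THEN continuous_on_compose2]) auto
  then have closed: "closed (K c)" for c
    unfolding K using h(2) by (intro lower_semicont_closed continuous_intros)
  have bounded: "bounded (K c)" for c
  proof -
    let ?C = "c - \<alpha> - inner \<beta> x" and ?N = "norm (g + \<beta>)" and ?M = "m1 / (2 * \<eta>)"
    have "norm (z - x) \<le> 1 + (\<bar>?C\<bar> + ?N) / ?M" if "z \<in> K c" for z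
    proof (rule quadratic_sublevel_bounded)
      have "ereal (\<alpha> + inner \<beta> z) \<le> ereal (c - \<phi> z)"
        using minorant[of z] that unfolding K mem_Collect_eq by (rule order_trans)
      then have "\<phi> z \<le> c - \<alpha> - inner \<beta> z" by simp
      moreover have "?M * (norm (z - x))\<^sup>2 \<le> 1 / (2 * \<eta>) * inner (z - x) (B *v (z - x))"
        using loewner_leD(1)[OF B, of "z - x"] pos by (simp add: divide_simps)
      moreover have "- inner (g + \<beta>) (z - x) \<le> ?N * norm (z - x)"
        using Cauchy_Schwarz_ineq2[of "g + \<beta>" "z - x"] by linarith
      ultimately show "?M * (norm (z - x))\<^sup>2 \<le> ?C + ?N * norm (z - x)"
        unfolding \<phi>_def by (simp add: inner_add_left inner_diff_right)
    qed (use pos in auto)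
    then have "K c \<subseteq> cball x (1 + (\<bar>?C\<bar> + ?N) / ?M)"
      by (auto simp: dist_norm norm_minus_commute)
    then show ?thesis using bounded_cball bounded_subset by blast
  qed
  have compact: "compact (K c)" for c using closed bounded by (simp add: compact_eq_bounded_closed)
  obtain z0 where "h z0 \<noteq> \<infinity>" using h(1) unfolding proper_fun_def by blast
  then obtain c0 where c0: "?J z0 = ereal c0"
    using h(1) unfolding proper_fun_def J by (metis ereal_cases plus_ereal.simps(1))
  \<comment> \<open>Any point in all nonempty sublevel sets is a minimiser; it exists since they are nested and compact.\<close>
  define T where "T = {c. c \<le> c0 \<and> K c \<noteq> {}}"
  have c0T: "c0 \<in> T" 
  proof -
    have "z0 \<in> K c0" unfolding K_def using c0 by simp
    then show ?thesis unfolding T_def by blast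
  qed
  have "K c0 \<inter> (\<Inter>c\<in>T. K c) \<noteq> {}"
  proof (rule compact_imp_fip_image[OF compact closed])
    fix I' assume I: "finite I'" "I' \<subseteq> T"
    have fin: "finite (insert c0 I')" using I by simp
    have "Min (insert c0 I') \<in> insert c0 I'" by (rule Min_in[OF fin]) simp
    then have "K (Min (insert c0 I')) \<noteq> {}" using I c0T unfolding T_def by auto
    moreover have "K (Min (insert c0 I')) \<subseteq> K c" if "c \<in> insert c0 I'" for c
    proof -
      have "ereal (Min (insert c0 I')) \<le> ereal c" using Min_le[OF fin that] by simp
      then show ?thesis unfolding K_def by (auto intro: order_trans)
    qed
    ultimately show "K c0 \<inter> (\<Inter>c\<in>I'. K c) \<noteq> {}" by fast
  qed
  then obtain p where p: "p \<in> K c0" "\<And>c. c \<in> T \<Longrightarrow> p \<in> K c" by auto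
  have "\<not> ?J y < ?J p" for y
  proof
    assume less: "?J y < ?J p"
    also have "?J p \<le> ereal c0" using p(1) unfolding K_def by simp
    finally have "?J y < ereal c0" .
    moreover have "?J y \<noteq> -\<infinity>" using h(1) unfolding proper_fun_def J by auto
    ultimately obtain c where c: "?J y = ereal c" "c \<le> c0" by (cases "?J y") auto
    then have "y \<in> K c" unfolding K_def by simp
    then have "c \<in> T" using c(2) unfolding T_def by blast
    then have "?J p \<le> ereal c" using p(2) unfolding K_def by blast
    then show False using less c(1) by (auto dest: leD)
  qed
  then have "is_arg_min ?J (\<lambda>_. True) p" unfolding is_arg_min_def by blast
  then show ?thesis unfolding prox_step_def by (rule someI)
qed

lemma prox_variational:
  fixes h :: "real^'d \<Rightarrow> ereal" and B :: "real^'d^'d"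
  assumes h: "proper_fun h" "ereal_convex h"
    and B: "m1 *\<^sub>R mat 1 \<preceq>\<^sub>L B" "B \<preceq>\<^sub>L m2 *\<^sub>R mat 1" and pos: "0 < m1" "0 < \<eta>"
    and p: "is_arg_min (prox_objective \<eta> h B x g) (\<lambda>_. True) p"
  shows "h p \<noteq> \<infinity>" and "h p \<le> h z + ereal (inner (g + (1 / \<eta>) *\<^sub>R (B *v (p - x))) (z - p))"
proof -
  define \<phi> where "\<phi> z = inner g (z - x) + 1 / (2 * \<eta>) * inner (z - x) (B *v (z - x))" for z
  have J: "prox_objective \<eta> h B x g = (\<lambda>z. ereal (\<phi> z) + h z)"
    unfolding prox_objective_def[abs_def] \<phi>_def using matrix_norm_sq[OF B] pos by simp
  have "\<phi> (p + t *\<^sub>R d) \<le> \<phi> p + t * inner (g + (1 / \<eta>) *\<^sub>R (B *v (p - x))) d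
      + t\<^sup>2 * (1 / (2 * \<eta>) * inner d (B *v d))" for d t
  proof -
    define u where "u = p - x"
    have w: "p + t *\<^sub>R d - x = u + t *\<^sub>R d" unfolding u_def by simp
    have s: "inner u (B *v d) = inner (B *v u) d" "inner d (B *v u) = inner (B *v u) d"
      using symmetric_inner[OF loewner_leD(3)[OF B], of u d] by (simp_all add: inner_commute)
    have "inner (u + t *\<^sub>R d) (B *v (u + t *\<^sub>R d))
      = inner u (B *v u) + 2 * t * inner (B *v u) d + t\<^sup>2 * inner d (B *v d)"
      by (simp add: matrix_vector_right_distrib matrix_vector_mult_scaleR inner_add_left
          inner_add_right s power2_eq_square distrib_left)
    moreover have "1 / (2 * \<eta>) * (\<alpha> + 2 * t * \<beta> + t\<^sup>2 * \<gamma>)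
      = 1 / (2 * \<eta>) * \<alpha> + t * (1 / \<eta> * \<beta>) + t\<^sup>2 * (1 / (2 * \<eta>) * \<gamma>)" for \<alpha> \<beta> \<gamma> :: real
      using pos by (simp add: field_simps)
    ultimately have "1 / (2 * \<eta>) * inner (u + t *\<^sub>R d) (B *v (u + t *\<^sub>R d))
      = 1 / (2 * \<eta>) * inner u (B *v u) + t * (1 / \<eta> * inner (B *v u) d)
        + t\<^sup>2 * (1 / (2 * \<eta>) * inner d (B *v d))" by simp
    moreover have "inner g (u + t *\<^sub>R d) = inner g u + t * inner g d"
      by (simp add: inner_add_right)
    moreover have "t * inner (g + (1 / \<eta>) *\<^sub>R (B *v u)) d
      = t * inner g d + t * (1 / \<eta> * inner (B *v u) d)"
      by (simp only: inner_add_left inner_scaleR_left distrib_left)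
    ultimately show ?thesis unfolding \<phi>_def w u_def[symmetric] by linarith
  qed
  note * = variational_inequality[OF h p[unfolded J] this]
  show "h p \<noteq> \<infinity>" by (rule *(1))
  show "h p \<le> h z + ereal (inner (g + (1 / \<eta>) *\<^sub>R (B *v (p - x))) (z - p))" by (rule *(2))
qed

text \<open>
  Adding the variational inequalities of the two steps cancels \<open>h\<close>, as in the proof that proximal maps are
  nonexpansive. The metric is allowed to differ, at the price of the term \<open>(B - B') p'\<close> in which only the
  second point occurs: this is what continuity at a fixed triple requires, and for equal metrics and centres
  it gives the Lipschitz bound in the gradient.
\<close>

lemma prox_stability:
  fixes h :: "real^'d \<Rightarrow> ereal" and B B' :: "real^'d^'d"
  assumes h: "proper_fun h" "ereal_convex h"
    and B: "m1 *\<^sub>R mat 1 \<preceq>\<^sub>L B" "B \<preceq>\<^sub>L m2 *\<^sub>R mat 1"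
    and B': "m1 *\<^sub>R mat 1 \<preceq>\<^sub>L B'" "B' \<preceq>\<^sub>L m2 *\<^sub>R mat 1"
    and pos: "0 < m1" "0 < \<eta>"
    and p: "is_arg_min (prox_objective \<eta> h B x g) (\<lambda>_. True) p"
    and p': "is_arg_min (prox_objective \<eta> h B' x' g') (\<lambda>_. True) p'"
  shows "m1 * norm (p - p') \<le> norm (\<eta> *\<^sub>R (g - g') + (B - B') *v p' - B *v x + B' *v x')"
    (is "_ \<le> norm ?R")
proof -
  define e where "e = p - p'"
  define w where "w = B *v (p - x)"
  define w' where "w' = B' *v (p' - x')"
  note V = prox_variational[OF h B pos p] and V' = prox_variational[OF h B' pos p']
  obtain hp hp' where hp: "h p = ereal hp" "h p' = ereal hp'"
    using V(1) V'(1) h(1) unfolding proper_fun_def by (metis ereal_cases)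
  have "hp \<le> hp' + inner (g + (1 / \<eta>) *\<^sub>R w) (p' - p)" using V(2)[of p'] hp by (simp add: w_def)
  moreover have "hp' \<le> hp + inner (g' + (1 / \<eta>) *\<^sub>R w') (p - p')"
    using V'(2)[of p] hp by (simp add: w'_def)
  ultimately have "0 \<le> - inner (g + (1 / \<eta>) *\<^sub>R w) e + inner (g' + (1 / \<eta>) *\<^sub>R w') e"
    unfolding e_def by (simp add: inner_diff_right)
  then have "0 \<le> \<eta> * (- inner (g + (1 / \<eta>) *\<^sub>R w) e + inner (g' + (1 / \<eta>) *\<^sub>R w') e)"
    using pos by simp
  then have "0 \<le> - inner (\<eta> *\<^sub>R (g - g') + (w - w')) e"
    using pos by (simp add: inner_add_left inner_diff_left algebra_simps)
  moreover have "w - w' = B *v e + ((B - B') *v p' - B *v x + B' *v x')"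
    unfolding w_def w'_def e_def
    by (simp add: matrix_vector_mult_diff_rdistrib matrix_vector_mult_diff_distrib)
  ultimately have "inner (B *v e) e \<le> - inner ?R e"
    by (simp add: inner_add_left inner_diff_left)
  also have "\<dots> \<le> norm ?R * norm e" using Cauchy_Schwarz_ineq2[of ?R e] by linarith
  finally have "m1 * norm e * norm e \<le> norm ?R * norm e"
    using loewner_leD(1)[OF B, of e] by (simp add: inner_commute power2_eq_square)
  then show ?thesis unfolding e_def[symmetric] by (cases "e = 0") auto
qed

section \<open>Dependence of the proximal step on its data\<close>

lemma continuous_on_matrix_vector_mult:
  fixes A :: "'a::topological_space \<Rightarrow> real^'m^'n"
  assumes "continuous_on T A" "continuous_on T u"
  shows "continuous_on T (\<lambda>z. A z *v u z)"
  unfolding matrix_vector_mult_def using assms by (intro continuous_intros)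

lemma closed_loewner_interval:
  "closed {B :: real^'d^'d. m1 *\<^sub>R mat 1 \<preceq>\<^sub>L B \<and> B \<preceq>\<^sub>L m2 *\<^sub>R mat 1}"
  unfolding loewner_le_def pos_semidef_def transpose_def
  by (intro closed_Collect_conj closed_Collect_all closed_Collect_eq closed_Collect_le
      continuous_on_matrix_vector_mult continuous_intros)

lemma continuous_on_prox_step:
  fixes h :: "real^'d \<Rightarrow> ereal"
  assumes h: "proper_fun h" "ereal_convex h" "lower_semicont h"
    and minorant: "\<And>z. ereal (\<alpha> + inner \<beta> z) \<le> h z" and pos: "0 < m1" "0 < \<eta>"
  shows "continuous_on ({B. m1 *\<^sub>R mat 1 \<preceq>\<^sub>L B \<and> B \<preceq>\<^sub>L m2 *\<^sub>R mat 1} \<times> UNIV)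
    (\<lambda>q. prox_step \<eta> h (fst q) (fst (snd q)) (snd (snd q)))"
    (is "continuous_on (?K \<times> _) ?p")
  unfolding continuous_on_def
proof
  fix q0 :: "(real^'d^'d) \<times> (real^'d) \<times> (real^'d)" assume q0: "q0 \<in> ?K \<times> UNIV"
  obtain B' x' g' where q0_eq: "q0 = (B', x', g')" by (cases q0)
  let ?F = "at q0 within ?K \<times> UNIV"
  define R where "R q = \<eta> *\<^sub>R (snd (snd q) - g') + (fst q - B') *v ?p q0
      - fst q *v fst (snd q) + B' *v x'" for q :: "(real^'d^'d) \<times> (real^'d) \<times> (real^'d)"
  have "continuous_on UNIV (\<lambda>q. norm (R q) / m1)"
    unfolding R_def using pos by (intro continuous_on_matrix_vector_mult continuous_intros) auto
  then have "((\<lambda>q. norm (R q) / m1) \<longlongrightarrow> norm (R q0) / m1) (at q0 within UNIV)"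
    unfolding continuous_on_def by blast
  then have "((\<lambda>q. norm (R q) / m1) \<longlongrightarrow> norm (R q0) / m1) ?F"
    by (rule tendsto_within_subset) simp
  moreover have "R q0 = 0" unfolding R_def q0_eq by simp
  ultimately have lim: "((\<lambda>q. norm (R q) / m1) \<longlongrightarrow> 0) ?F" by simp
  have "\<forall>\<^sub>F q in ?F. norm (?p q - ?p q0) \<le> norm (R q) / m1"
    unfolding eventually_at_filter
  proof (intro always_eventually allI impI)
    fix q :: "(real^'d^'d) \<times> (real^'d) \<times> (real^'d)" assume q: "q \<in> ?K \<times> UNIV"
    obtain B x g where q_eq: "q = (B, x, g)" by (cases q)
    have adm: "m1 *\<^sub>R mat 1 \<preceq>\<^sub>L B" "B \<preceq>\<^sub>L m2 *\<^sub>R mat 1"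
      "m1 *\<^sub>R mat 1 \<preceq>\<^sub>L B'" "B' \<preceq>\<^sub>L m2 *\<^sub>R mat 1"
      using q q0 unfolding q_eq q0_eq by auto
    have "m1 * norm (?p q - ?p q0) \<le> norm (R q)"
      using prox_stability[OF h(1,2) adm pos prox_step_exists[OF h(1,3) minorant adm(1,2) pos]
          prox_step_exists[OF h(1,3) minorant adm(3,4) pos]]
      unfolding R_def q_eq q0_eq by simp
    then show "norm (?p q - ?p q0) \<le> norm (R q) / m1"
      using pos by (simp add: field_simps)
  qed
  then have "((\<lambda>q. ?p q - ?p q0) \<longlongrightarrow> 0) ?F" by (rule Lim_null_comparison[OF _ lim])
  then show "(?p \<longlongrightarrow> ?p q0) ?F" by (simp add: LIM_zero_iff)
qed

text \<open>
  Continuity is available on the closed set of admissible metrics only; outside of it the value \<open>0\<close> is a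
  placeholder.
\<close>

lemma borel_measurable_prox_step:
  fixes h :: "real^'d \<Rightarrow> ereal"
  assumes h: "proper_fun h" "ereal_convex h" "lower_semicont h"
    and minorant: "\<And>z. ereal (\<alpha> + inner \<beta> z) \<le> h z" and pos: "0 < m1" "0 < \<eta>"
    and meas: "B \<in> borel_measurable N" "x \<in> borel_measurable N" "g \<in> borel_measurable N"
  shows "(\<lambda>\<omega>. if m1 *\<^sub>R mat 1 \<preceq>\<^sub>L B \<omega> \<and> B \<omega> \<preceq>\<^sub>L m2 *\<^sub>R mat 1
      then prox_step \<eta> h (B \<omega>) (x \<omega>) (g \<omega>) else 0) \<in> borel_measurable N"
proof -
  let ?K = "{B. m1 *\<^sub>R mat 1 \<preceq>\<^sub>L B \<and> B \<preceq>\<^sub>L m2 *\<^sub>R mat 1} :: (real^'d^'d) set"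
  let ?f = "\<lambda>q. if q \<in> ?K \<times> UNIV then prox_step \<eta> h (fst q) (fst (snd q)) (snd (snd q)) else 0"
  have "?f \<in> borel_measurable borel"
    by (rule borel_measurable_continuous_on_if[OF _ continuous_on_prox_step[OF assms(1-6)]
          continuous_on_const])
      (intro borel_closed closed_Times closed_loewner_interval closed_UNIV)
  moreover have "(\<lambda>\<omega>. (B \<omega>, x \<omega>, g \<omega>)) \<in> borel_measurable N"
    using meas by (intro borel_measurable_Pair)
  ultimately have "(\<lambda>\<omega>. ?f (B \<omega>, x \<omega>, g \<omega>)) \<in> borel_measurable N"
    by (rule measurable_compose_rev)
  then show ?thesis by (simp cong: if_cong)
qed

text \<open>
  The sum of three inequalities: the optimality condition at \<open>p\<close>, strong convexity from \<open>x\<close> to \<open>xs\<close> and the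
  descent inequality from \<open>x\<close> to \<open>p\<close>. The step is taken along an arbitrary \<open>g\<close> in place of \<open>G = \<nabla>f(x)\<close>.
  The hypothesis \<open>\<eta> L \<le> m1\<close> lets the term \<open>- \<parallel>p - x\<parallel>\<^sup>2\<close> of the three-point identity in the metric \<open>B\<close> absorb
  the curvature term of the descent inequality.
\<close>

lemma prox_descent:
  fixes h :: "real^'d \<Rightarrow> ereal" and B :: "real^'d^'d"
  assumes h: "proper_fun h" "ereal_convex h"
    and B: "m1 *\<^sub>R mat 1 \<preceq>\<^sub>L B" "B \<preceq>\<^sub>L m2 *\<^sub>R mat 1"
    and pos: "0 < m1" "0 < m2" "0 < \<eta>" "0 \<le> \<mu>" "\<eta> * L \<le> m1"
    and lower: "f x + inner G (xs - x) + \<mu> / 2 * (norm (xs - x))\<^sup>2 \<le> f xs"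
    and upper: "f p \<le> f x + inner G (p - x) + L / 2 * (norm (p - x))\<^sup>2"
    and p: "is_arg_min (prox_objective \<eta> h B x g) (\<lambda>_. True) p"
    and fin: "h p = ereal hp" "h xs = ereal hs"
  shows "inner (p - xs) (B *v (p - xs)) + 2 * \<eta> * ((f p + hp) - (f xs + hs))
    \<le> (1 - \<eta> * \<mu> / m2) * inner (x - xs) (B *v (x - xs)) - 2 * \<eta> * inner (g - G) (p - xs)"
proof -
  define w where "w = B *v (p - x)"
  define Q where "Q u = inner u (B *v u)" for u
  have "hp \<le> hs + inner (g + (1 / \<eta>) *\<^sub>R w) (xs - p)"
    using prox_variational(2)[OF h B pos(1,3) p, of xs] fin by (simp add: w_def)
  with lower upper have "(f p + hp) - (f xs + hs)
    \<le> inner G (p - x) - inner G (xs - x) - \<mu> / 2 * (norm (xs - x))\<^sup>2 + L / 2 * (norm (p - x))\<^sup>2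
      + inner (g + (1 / \<eta>) *\<^sub>R w) (xs - p)" by linarith
  also have "\<dots> = - inner (g - G) (p - xs) - \<mu> / 2 * (norm (xs - x))\<^sup>2
      + L / 2 * (norm (p - x))\<^sup>2 + 1 / \<eta> * inner w (xs - p)"
    by (simp add: inner_add_left inner_diff_left inner_diff_right diff_divide_distrib)
  finally have "2 * \<eta> * ((f p + hp) - (f xs + hs)) \<le> 2 * \<eta> * (- inner (g - G) (p - xs)
      - \<mu> / 2 * (norm (xs - x))\<^sup>2 + L / 2 * (norm (p - x))\<^sup>2 + 1 / \<eta> * inner w (xs - p))"
    using pos by (intro mult_left_mono) auto
  also have "\<dots> = - 2 * \<eta> * inner (g - G) (p - xs) - \<eta> * \<mu> * (norm (xs - x))\<^sup>2
      + \<eta> * L * (norm (p - x))\<^sup>2 + 2 * inner w (xs - p)"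
    using pos by (simp add: field_simps)
  finally have main: "2 * \<eta> * ((f p + hp) - (f xs + hs)) \<le> \<dots>" .
  have polar: "2 * inner w (xs - p) = Q (x - xs) - Q (p - x) - Q (p - xs)"
  proof -
    define a where "a = p - x"
    define b where "b = xs - p"
    have e: "x - xs = - (a + b)" "p - xs = - b" "p - x = a" by (simp_all add: a_def b_def)
    have "B *v (- u) = - (B *v u)" for u
      using matrix_vector_mult_diff_distrib[of B 0 u] by simp
    then have neg: "Q (- u) = Q u" for u unfolding Q_def by simp
    have "inner b (B *v a) = inner (B *v a) b" "inner a (B *v b) = inner (B *v a) b"
      using symmetric_inner[OF loewner_leD(3)[OF B], of a b] by (simp_all add: inner_commute)
    then show ?thesis
      unfolding w_def e neg b_def[symmetric] unfolding Q_def
      by (simp add: matrix_vector_right_distrib inner_add_left inner_add_right)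
  qed
  have "\<eta> * L * (norm (p - x))\<^sup>2 \<le> m1 * (norm (p - x))\<^sup>2" using pos by (intro mult_right_mono) auto
  also have "\<dots> \<le> Q (p - x)" unfolding Q_def by (rule loewner_leD(1)[OF B])
  finally have q1: "\<eta> * L * (norm (p - x))\<^sup>2 \<le> Q (p - x)" .
  have "\<eta> * \<mu> / m2 * Q (x - xs) \<le> \<eta> * \<mu> / m2 * (m2 * (norm (x - xs))\<^sup>2)"
    unfolding Q_def using pos by (intro mult_left_mono loewner_leD(2)[OF B]) auto
  then have q2: "\<eta> * \<mu> / m2 * Q (x - xs) \<le> \<eta> * \<mu> * (norm (xs - x))\<^sup>2"
    using pos by (simp add: norm_minus_commute)
  have "(1 - \<eta> * \<mu> / m2) * Q (x - xs) = Q (x - xs) - \<eta> * \<mu> / m2 * Q (x - xs)"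
    by (simp add: algebra_simps)
  with main polar q1 q2 show ?thesis unfolding Q_def[symmetric] by linarith
qed

section \<open>Measurability of the L-BFGS matrix\<close>

lemma borel_measurable_vec_lambda:
  fixes g :: "'i::finite \<Rightarrow> 'w \<Rightarrow> 'b::euclidean_space"
  assumes "\<And>i. g i \<in> borel_measurable N"
  shows "(\<lambda>\<omega>. \<chi> i. g i \<omega>) \<in> borel_measurable N"
proof (rule borel_measurable_euclidean_space[THEN iffD2], rule ballI)
  fix b :: "'b^'i" assume "b \<in> Basis"
  then obtain i u where "b = axis i u" by (auto simp: Basis_vec_def)
  then show "(\<lambda>\<omega>. inner (\<chi> i. g i \<omega>) b) \<in> borel_measurable N"
    using assms by (simp add: inner_axis)
qed

lemma borel_measurable_vec_nth:
  fixes g :: "'w \<Rightarrow> 'b::euclidean_space^'i"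
  assumes "g \<in> borel_measurable N"
  shows "(\<lambda>\<omega>. vec_nth (g \<omega>) i) \<in> borel_measurable N"
  using assms by (rule borel_measurable_continuous_on[rotated]) (intro continuous_intros)

lemma borel_measurable_matrix_vector_mult:
  fixes A :: "'w \<Rightarrow> real^'m^'n"
  assumes "A \<in> borel_measurable N" "u \<in> borel_measurable N"
  shows "(\<lambda>\<omega>. A \<omega> *v u \<omega>) \<in> borel_measurable N"
  unfolding matrix_vector_mult_def
  using assms by (intro borel_measurable_vec_lambda borel_measurable_sum borel_measurable_times
      borel_measurable_vec_nth)

lemma borel_measurable_det:
  fixes A :: "'w \<Rightarrow> real Matrix.mat"
  assumes dim: "\<And>\<omega>. A \<omega> \<in> carrier_mat k k"
    and meas: "\<And>i j. i < k \<Longrightarrow> j < k \<Longrightarrow> (\<lambda>\<omega>. A \<omega> $$ (i, j)) \<in> borel_measurable N"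
  shows "(\<lambda>\<omega>. Determinant.det (A \<omega>)) \<in> borel_measurable N"
proof -
  have "(\<lambda>\<omega>. Determinant.det (A \<omega>)) = (\<lambda>\<omega>. \<Sum>p\<in>{p. p permutes {0..<k}}.
      signof p * (\<Prod>i=0..<k. A \<omega> $$ (i, p i)))"
    by (simp add: det_def'[OF dim])
  also have "\<dots> \<in> borel_measurable N"
    using meas by (intro borel_measurable_sum borel_measurable_times borel_measurable_prod
        borel_measurable_const) auto
  finally show ?thesis .
qed

lemma mat_inverse_nonsingular:
  fixes A :: "real Matrix.mat"
  assumes A: "A \<in> carrier_mat k k" and "Determinant.det A \<noteq> 0"
  shows "the (mat_inverse A) = (1 / Determinant.det A) \<cdot>\<^sub>m adj_mat A"
proof -
  have "A \<in> Units (ring_mat TYPE(real) k ())"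
    using det_non_zero_imp_unit[OF assms] .
  then obtain C where C: "mat_inverse A = Some C" using mat_inverse(1)[OF A] by fastforce
  have inv: "A * C = 1\<^sub>m k" "C \<in> carrier_mat k k" using mat_inverse(2)[OF A C] by auto
  have adj: "adj_mat A \<in> carrier_mat k k" "adj_mat A * A = Determinant.det A \<cdot>\<^sub>m 1\<^sub>m k"
    using adj_mat[OF A] by auto
  have "adj_mat A = adj_mat A * (A * C)" using adj(1) inv by simp
  also have "\<dots> = (adj_mat A * A) * C" using adj(1) A inv(2) by simp
  also have "\<dots> = Determinant.det A \<cdot>\<^sub>m C" using inv(2)
    by (simp add: adj(2) mult_smult_assoc_mat[of _ k k _ k])
  finally show ?thesis using assms(2) C by (auto intro!: eq_matI)
qed

lemma mat_inverse_singular: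
  fixes A :: "real Matrix.mat"
  assumes A: "A \<in> carrier_mat k k" and "Determinant.det A = 0"
  shows "mat_inverse A = None"
proof (rule ccontr)
  assume "mat_inverse A \<noteq> None"
  then obtain C where "mat_inverse A = Some C" by blast
  from mat_inverse(2)[OF A this] have "A * C = 1\<^sub>m k" "C \<in> carrier_mat k k" by auto
  then have "Determinant.det A * Determinant.det C = 1" using det_mult[OF A, of C] by simp
  then show False using assms(2) by simp
qed

text \<open>
  Where the determinant vanishes the inverse is the unspecified matrix \<open>the None\<close>, whose dimension is
  unknown, so that entries of vectors beyond their length may occur in the product. All of these are
  constants, so that both branches of the case distinction are measurable.
\<close>

lemma borel_measurable_mat_inverse_form:
  fixes A :: "'w \<Rightarrow> real Matrix.mat" and u w :: "nat \<Rightarrow> 'w \<Rightarrow> real"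
  assumes dim: "\<And>\<omega>. A \<omega> \<in> carrier_mat k k"
    and A: "\<And>i j. i < k \<Longrightarrow> j < k \<Longrightarrow> (\<lambda>\<omega>. A \<omega> $$ (i, j)) \<in> borel_measurable N"
    and u: "\<And>i. i < k \<Longrightarrow> u i \<in> borel_measurable N"
    and w: "\<And>i. i < k \<Longrightarrow> w i \<in> borel_measurable N"
  shows "(\<lambda>\<omega>. scalar_prod (Matrix.vec k (\<lambda>i. u i \<omega>))
      (the (mat_inverse (A \<omega>)) *\<^sub>v Matrix.vec k (\<lambda>i. w i \<omega>))) \<in> borel_measurable N"
proof -
  let ?N0 = "the None :: real Matrix.mat"
  define g0 where "g0 \<omega> = scalar_prod (Matrix.vec k (\<lambda>i. u i \<omega>)) (?N0 *\<^sub>v Matrix.vec k (\<lambda>i. w i \<omega>))" for \<omega>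
  define g1 where "g1 \<omega> = (\<Sum>i<k. u i \<omega> * (\<Sum>j<k. adj_mat (A \<omega>) $$ (i, j) / Determinant.det (A \<omega>) * w j \<omega>))" for \<omega>
  have det: "(\<lambda>\<omega>. Determinant.det (A \<omega>)) \<in> borel_measurable N"
    by (rule borel_measurable_det[OF dim A])
  have adj: "(\<lambda>\<omega>. adj_mat (A \<omega>) $$ (i, j)) \<in> borel_measurable N" if ij: "i < k" "j < k" for i j
  proof -
    have "(\<lambda>\<omega>. Determinant.det (mat_delete (A \<omega>) j i)) \<in> borel_measurable N"
    proof (rule borel_measurable_det)
      show "mat_delete (A \<omega>) j i \<in> carrier_mat (k - 1) (k - 1)" for \<omega>
        using mat_delete_carrier[OF dim[of \<omega>]] .
      show "(\<lambda>\<omega>. mat_delete (A \<omega>) j i $$ (i', j')) \<in> borel_measurable N"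
        if "i' < k - 1" "j' < k - 1" for i' j'
      proof -
        have "mat_delete (A \<omega>) j i $$ (i', j')
          = A \<omega> $$ (if i' < j then i' else Suc i', if j' < i then j' else Suc j')" for \<omega>
          using dim[of \<omega>] that unfolding mat_delete_def by auto
        then show ?thesis using that by (auto intro!: A)
      qed
    qed
    moreover have "adj_mat (A \<omega>) $$ (i, j) = (-1) ^ (j + i) * Determinant.det (mat_delete (A \<omega>) j i)" for \<omega>
      using dim[of \<omega>] ij unfolding adj_mat_def cofactor_def by auto
    ultimately show ?thesis by simp
  qed
  have g1: "g1 \<in> borel_measurable N"
    unfolding g1_def[abs_def] using det adj u w
    by (intro borel_measurable_sum borel_measurable_times borel_measurable_divide) auto
  have entry: "(\<lambda>\<omega>. Matrix.vec_index (Matrix.vec k (\<lambda>i. c i \<omega>)) i) \<in> borel_measurable N"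
    if "\<And>i. i < k \<Longrightarrow> c i \<in> borel_measurable N" for c :: "nat \<Rightarrow> 'w \<Rightarrow> real" and i
  proof (cases "i < k")
    case False
    then have "Matrix.vec_index (Matrix.vec k (\<lambda>i. c i \<omega>)) i
      = Matrix.vec_index (Matrix.vec k (\<lambda>i. 0)) i" for \<omega>
      by (transfer) (simp add: mk_vec_def)
    then show ?thesis by simp
  qed (use that in simp)
  have g0: "g0 \<in> borel_measurable N"
  proof -
    have "g0 \<omega> = (\<Sum>i = 0..<dim_row ?N0. Matrix.vec_index (Matrix.vec k (\<lambda>i. u i \<omega>)) i
        * (\<Sum>j = 0..<k. Matrix.vec_index (row ?N0 i) j * w j \<omega>))" for \<omega>
      unfolding g0_def scalar_prod_def[of _ "_ *\<^sub>v _"]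
      by (auto simp: scalar_prod_def intro!: sum.cong)
    then have "g0 = (\<lambda>\<omega>. \<Sum>i = 0..<dim_row ?N0. Matrix.vec_index (Matrix.vec k (\<lambda>i. u i \<omega>)) i
        * (\<Sum>j = 0..<k. Matrix.vec_index (row ?N0 i) j * w j \<omega>))" by (rule ext)
    then show ?thesis
      using u w by (auto intro!: borel_measurable_sum borel_measurable_times entry)
  qed
  have "scalar_prod (Matrix.vec k (\<lambda>i. u i \<omega>)) (the (mat_inverse (A \<omega>)) *\<^sub>v Matrix.vec k (\<lambda>i. w i \<omega>))
    = (if Determinant.det (A \<omega>) = 0 then g0 \<omega> else g1 \<omega>)" for \<omega>
  proof (cases "Determinant.det (A \<omega>) = 0")
    case True
    then show ?thesis using mat_inverse_singular[OF dim] by (simp add: g0_def)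
  next
    case False
    have adj: "adj_mat (A \<omega>) \<in> carrier_mat k k" using adj_mat[OF dim] by auto
    show ?thesis
      unfolding mat_inverse_nonsingular[OF dim False] g1_def using False adj
      by (auto simp: scalar_prod_def row_def lessThan_atLeast0 intro!: sum.cong)
  qed
  then show ?thesis using det g0 g1 by simp
qed

lemma lbfgs_middle_carrier: "lbfgs_middle \<sigma> m s y \<in> carrier_mat (2 * m) (2 * m)"
  unfolding lbfgs_middle_def Let_def
  by (rule carrier_matI) (simp_all add: mult_2)

lemma borel_measurable_lbfgs:
  fixes s y :: "nat \<Rightarrow> 'w \<Rightarrow> real^'d"
  assumes m: "1 \<le> m"
    and s: "\<And>j. 1 \<le> j \<Longrightarrow> j \<le> m \<Longrightarrow> s j \<in> borel_measurable N"
    and y: "\<And>j. 1 \<le> j \<Longrightarrow> j \<le> m \<Longrightarrow> y j \<in> borel_measurable N"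
  shows "(\<lambda>\<omega>. lbfgs m (\<lambda>j. s j \<omega>) (\<lambda>j. y j \<omega>)) \<in> borel_measurable N"
proof -
  define \<sigma> where "\<sigma> \<omega> = inner (y m \<omega>) (y m \<omega>) / inner (y m \<omega>) (s m \<omega>)" for \<omega>
  define W where "W a i \<omega> = (if i < m then \<sigma> \<omega> * vec_nth (s (i + 1) \<omega>) a
      else vec_nth (y (i - m + 1) \<omega>) a)" for a i \<omega>
  let ?A = "\<lambda>\<omega>. lbfgs_middle (\<sigma> \<omega>) m (\<lambda>j. s j \<omega>) (\<lambda>j. y j \<omega>)"
  have \<sigma>: "\<sigma> \<in> borel_measurable N"
    unfolding \<sigma>_def[abs_def] using m s y
    by (intro borel_measurable_divide borel_measurable_inner) auto
  have W: "W a i \<in> borel_measurable N" if "i < 2 * m" for a i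
    unfolding W_def[abs_def] using that s y \<sigma>
    by (cases "i < m") (auto intro!: borel_measurable_times borel_measurable_vec_nth)
  have A: "(\<lambda>\<omega>. ?A \<omega> $$ (i, j)) \<in> borel_measurable N" if "i < 2 * m" "j < 2 * m" for i j
  proof -
    have "?A \<omega> $$ (i, j) = (if i < m then
        if j < m then \<sigma> \<omega> * inner (s (i + 1) \<omega>) (s (j + 1) \<omega>)
        else if i > j - m then inner (s (i + 1) \<omega>) (y (j - m + 1) \<omega>) else 0
      else if j < m then if j > i - m then inner (s (j + 1) \<omega>) (y (i - m + 1) \<omega>) else 0
        else if i = j then - inner (s (i - m + 1) \<omega>) (y (i - m + 1) \<omega>) else 0)" for \<omega>
      using that unfolding lbfgs_middle_def Let_def by auto
    then show ?thesis using that s y \<sigma>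
      by (cases "i < m"; cases "j < m"; cases "j - m < i"; cases "i - m < j"; cases "i = j")
        (auto intro!: borel_measurable_times borel_measurable_inner borel_measurable_uminus)
  qed
  have "lbfgs m (\<lambda>j. s j \<omega>) (\<lambda>j. y j \<omega>) = \<sigma> \<omega> *\<^sub>R mat 1 - (\<chi> a b.
      scalar_prod (Matrix.vec (2 * m) (\<lambda>i. W a i \<omega>))
        (the (mat_inverse (?A \<omega>)) *\<^sub>v Matrix.vec (2 * m) (\<lambda>i. W b i \<omega>)))" for \<omega>
    unfolding lbfgs_def Let_def \<sigma>_def W_def by simp
  then show ?thesis
    using \<sigma> W A lbfgs_middle_carrier
    by (simp, intro borel_measurable_diff borel_measurable_scaleR borel_measurable_const
        borel_measurable_vec_lambda borel_measurable_mat_inverse_form) auto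
qed

section \<open>Histories, conditional means and square-integrable noise\<close>

lemma history_sub_measurable_map:
  assumes x: "\<And>k. x k \<in> borel_measurable M" and \<phi>: "\<And>k. \<phi> k \<in> measurable M P"
    and S: "\<And>t. 1 \<le> t \<Longrightarrow> S t \<in> measurable M (count_space (Pow {1..n}))"
  shows "(\<lambda>\<omega>. (\<lambda>i\<in>{..k}. (x i \<omega>, \<phi> i \<omega>), \<lambda>t\<in>{1..k div r}. S t \<omega>))
    \<in> measurable M ((\<Pi>\<^sub>M i\<in>{..k}. borel \<Otimes>\<^sub>M P) \<Otimes>\<^sub>M (\<Pi>\<^sub>M t\<in>{1..k div r}. count_space (Pow {1..n})))"
  using assms by (intro measurable_Pair measurable_restrict) auto

lemma vimage_subalgebra:
  assumes "g \<in> measurable M N"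
  shows "subalgebra M (vimage_algebra (space M) g N)"
  unfolding subalgebra_def
proof
  have "g \<in> space M \<rightarrow> space N" using measurable_space[OF assms] by blast
  then show "sets (vimage_algebra (space M) g N) \<subseteq> sets M"
    using measurable_sets[OF assms] by (auto simp: sets_vimage_algebra2)
qed simp

lemma subalgebra_history:
  assumes "\<And>k. x k \<in> borel_measurable M" and "\<And>k. \<phi> k \<in> measurable M P"
  shows "subalgebra M (history M P x \<phi> k)"
  unfolding history_def
  using assms by (intro vimage_subalgebra measurable_restrict measurable_Pair)

lemma
  assumes x: "\<And>k. x k \<in> borel_measurable M" and \<phi>: "\<And>k. \<phi> k \<in> measurable M P"
    and S: "\<And>t. 1 \<le> t \<Longrightarrow> S t \<in> measurable M (count_space (Pow {1..n}))"
  shows subalgebra_history_sub: "subalgebra M (history_sub M P n r x \<phi> S k)"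
    and iterate_history_sub: "i \<le> k \<Longrightarrow> x i \<in> borel_measurable (history_sub M P n r x \<phi> S k)"
    and sample_history_sub: "1 \<le> t \<Longrightarrow> t \<le> k div r \<Longrightarrow>
        S t \<in> measurable (history_sub M P n r x \<phi> S k) (count_space (Pow {1..n}))"
proof -
  let ?N1 = "\<Pi>\<^sub>M i\<in>{..k}. borel \<Otimes>\<^sub>M P"
  let ?N2 = "\<Pi>\<^sub>M t\<in>{1..k div r}. count_space (Pow {1..n})"
  let ?g = "\<lambda>\<omega>. (\<lambda>i\<in>{..k}. (x i \<omega>, \<phi> i \<omega>), \<lambda>t\<in>{1..k div r}. S t \<omega>)"
  note g = history_sub_measurable_map[where x = x and \<phi> = \<phi> and S = S, OF assms, of k r]
  show "subalgebra M (history_sub M P n r x \<phi> S k)"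
    unfolding history_sub_def by (rule vimage_subalgebra[OF g])
  have "?g \<in> space M \<rightarrow> space (?N1 \<Otimes>\<^sub>M ?N2)" using measurable_space[OF g] by blast
  then have G: "?g \<in> measurable (history_sub M P n r x \<phi> S k) (?N1 \<Otimes>\<^sub>M ?N2)"
    unfolding history_sub_def by (rule measurable_vimage_algebra1)
  show "x i \<in> borel_measurable (history_sub M P n r x \<phi> S k)" if "i \<le> k"
  proof -
    have "(\<lambda>q. fst q i) \<in> measurable (?N1 \<Otimes>\<^sub>M ?N2) (borel \<Otimes>\<^sub>M P)"
      using that by (intro measurable_compose[OF measurable_fst measurable_component_singleton]) auto
    from measurable_compose[OF G measurable_compose[OF this measurable_fst]] show ?thesis using that by simp
  qed
  show "S t \<in> measurable (history_sub M P n r x \<phi> S k) (count_space (Pow {1..n}))"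
    if "1 \<le> t" "t \<le> k div r"
  proof -
    have "(\<lambda>q. snd q t) \<in> measurable (?N1 \<Otimes>\<^sub>M ?N2) (count_space (Pow {1..n}))"
      using that by (intro measurable_compose[OF measurable_snd measurable_component_singleton]) auto
    from measurable_compose[OF G this] show ?thesis using that by simp
  qed
qed

text \<open>
  The pairs in memory at iteration \<open>k\<close> have indices from \<open>1\<close> to \<open>k div r\<close>, hence involve iterates up to \<open>x k\<close>
  and the samples drawn so far. A sample takes finitely many values, and the Hessian is continuous for each.
\<close>

lemma borel_measurable_qn_metric:
  fixes f :: "nat \<Rightarrow> real^'d \<Rightarrow> real" and x :: "nat \<Rightarrow> 'w \<Rightarrow> real^'d"
  assumes smooth: "\<And>i. i \<in> {1..n} \<Longrightarrow> twice_cont_differentiable (f i)"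
    and "0 < r" and memory: "\<And>t. 1 \<le> t \<Longrightarrow> 1 \<le> mem t \<and> mem t \<le> t"
    and x: "\<And>j. j \<le> k \<Longrightarrow> x j \<in> borel_measurable N"
    and S: "\<And>t. 1 \<le> t \<Longrightarrow> t \<le> k div r \<Longrightarrow> S t \<in> measurable N (count_space (Pow {1..n}))"
  shows "(\<lambda>\<omega>. qn_metric f r mem (\<lambda>j. x j \<omega>) (\<lambda>j. S j \<omega>) k) \<in> borel_measurable N"
proof (cases "k < r")
  case True
  then show ?thesis by (simp add: qn_metric_def)
next
  case False
  define t where "t = k div r"
  have t: "1 \<le> t" using False \<open>0 < r\<close> unfolding t_def by (simp add: Suc_le_eq div_greater_zero_iff)
  have mem: "1 \<le> mem t" "mem t \<le> t" using memory[OF t] by auto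
  have avg: "(\<lambda>\<omega>. ref_avg r (\<lambda>j. x j \<omega>) s) \<in> borel_measurable N" if "s \<le> t" for s
  proof (cases "s = 0")
    case False
    have "s * r \<le> k" using that unfolding t_def
      by (meson div_times_less_eq_dividend le_trans mult_le_mono1)
    then show ?thesis using False x unfolding ref_avg_def
      by (auto intro!: borel_measurable_scaleR borel_measurable_sum)
  qed (simp add: ref_avg_def)
  have cs: "(\<lambda>\<omega>. corr_s r (\<lambda>j. x j \<omega>) s) \<in> borel_measurable N" if "s \<le> t" for s
    unfolding corr_s_def using that by (intro borel_measurable_diff avg) auto
  have cy: "(\<lambda>\<omega>. corr_y f r (\<lambda>j. x j \<omega>) (\<lambda>j. S j \<omega>) s) \<in> borel_measurable N"
    if "1 \<le> s" "s \<le> t" for s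
    unfolding corr_y_def
  proof (intro borel_measurable_matrix_vector_mult cs that(2))
    show "(\<lambda>\<omega>. hess (subsample_avg f (S s \<omega>)) (ref_avg r (\<lambda>j. x j \<omega>) s)) \<in> borel_measurable N"
    proof (rule measurable_compose_countable'[where
          f = "\<lambda>T \<omega>. hess (subsample_avg f T) (ref_avg r (\<lambda>j. x j \<omega>) s)"])
      fix T assume "T \<in> Pow {1..n}"
      then have "twice_cont_differentiable (subsample_avg f T)"
        by (intro twice_cont_differentiable_subsample_avg smooth) auto
      then have "continuous_on UNIV (hess (subsample_avg f T))"
        unfolding twice_cont_differentiable_def by blast
      then show "(\<lambda>\<omega>. hess (subsample_avg f T) (ref_avg r (\<lambda>j. x j \<omega>) s)) \<in> borel_measurable N"
        by (rule borel_measurable_continuous_on[OF _ avg[OF that(2)]])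
    qed (use S that in \<open>auto simp: t_def countable_finite\<close>)
  qed
  have "(\<lambda>\<omega>. lbfgs (mem t) (\<lambda>j. corr_s r (\<lambda>j. x j \<omega>) (t - mem t + j))
      (\<lambda>j. corr_y f r (\<lambda>j. x j \<omega>) (\<lambda>j. S j \<omega>) (t - mem t + j))) \<in> borel_measurable N"
    using mem by (intro borel_measurable_lbfgs cs cy) auto
  then show ?thesis using False by (simp add: qn_metric_def t_def Let_def)
qed

lemma integrable_inner_of_squares:
  fixes u w :: "'w \<Rightarrow> real^'d"
  assumes "u \<in> borel_measurable M" "w \<in> borel_measurable M"
    and "integrable M (\<lambda>\<omega>. (norm (u \<omega>))\<^sup>2)" "integrable M (\<lambda>\<omega>. (norm (w \<omega>))\<^sup>2)"
  shows "integrable M (\<lambda>\<omega>. inner (u \<omega>) (w \<omega>))"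
    and "integrable M (\<lambda>\<omega>. vec_nth (u \<omega>) i * vec_nth (w \<omega>) i)"
proof -
  have bound: "norm (u \<omega>) * norm (w \<omega>) \<le> norm ((norm (u \<omega>))\<^sup>2 + (norm (w \<omega>))\<^sup>2)" for \<omega>
  proof -
    have "0 \<le> norm (u \<omega>) * norm (w \<omega>)" by simp
    then have "norm (u \<omega>) * norm (w \<omega>) \<le> (norm (u \<omega>))\<^sup>2 + (norm (w \<omega>))\<^sup>2"
      using sum_squares_bound[of "norm (u \<omega>)" "norm (w \<omega>)"] by linarith
    then show ?thesis by simp
  qed
  have int: "integrable M (\<lambda>\<omega>. (norm (u \<omega>))\<^sup>2 + (norm (w \<omega>))\<^sup>2)"
    using assms by (intro Bochner_Integration.integrable_add)
  show "integrable M (\<lambda>\<omega>. inner (u \<omega>) (w \<omega>))"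
  proof (rule Bochner_Integration.integrable_bound[OF int])
    show "AE \<omega> in M. norm (inner (u \<omega>) (w \<omega>)) \<le> norm ((norm (u \<omega>))\<^sup>2 + (norm (w \<omega>))\<^sup>2)"
      using order_trans[OF Cauchy_Schwarz_ineq2 bound] by simp
  qed (use assms in simp)
  show "integrable M (\<lambda>\<omega>. vec_nth (u \<omega>) i * vec_nth (w \<omega>) i)"
  proof (rule Bochner_Integration.integrable_bound[OF int])
    have "norm (vec_nth (u \<omega>) i * vec_nth (w \<omega>) i) \<le> norm (u \<omega>) * norm (w \<omega>)" for \<omega>
      unfolding norm_mult by (intro mult_mono) (auto simp: component_le_norm_cart)
    then show "AE \<omega> in M. norm (vec_nth (u \<omega>) i * vec_nth (w \<omega>) i)
        \<le> norm ((norm (u \<omega>))\<^sup>2 + (norm (w \<omega>))\<^sup>2)"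
      using bound by (auto intro: order_trans)
  qed (use assms in \<open>auto intro!: borel_measurable_times borel_measurable_vec_nth\<close>)
qed

lemma integrable_square_of_diff:
  fixes v g :: "'w \<Rightarrow> 'b::euclidean_space"
  assumes "v \<in> borel_measurable M"
    and "integrable M (\<lambda>\<omega>. (norm (v \<omega> - g \<omega>))\<^sup>2)" "integrable M (\<lambda>\<omega>. (norm (g \<omega>))\<^sup>2)"
  shows "integrable M (\<lambda>\<omega>. (norm (v \<omega>))\<^sup>2)"
proof (rule Bochner_Integration.integrable_bound)
  show "integrable M (\<lambda>\<omega>. 2 * (norm (v \<omega> - g \<omega>))\<^sup>2 + 2 * (norm (g \<omega>))\<^sup>2)"
    using assms by (intro Bochner_Integration.integrable_add integrable_mult_right)
  have "(norm (v \<omega>))\<^sup>2 \<le> 2 * (norm (v \<omega> - g \<omega>))\<^sup>2 + 2 * (norm (g \<omega>))\<^sup>2" for \<omega>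
  proof -
    have "norm (v \<omega>) \<le> norm (v \<omega> - g \<omega>) + norm (g \<omega>)"
      using norm_triangle_ineq[of "v \<omega> - g \<omega>" "g \<omega>"] by simp
    then have "(norm (v \<omega>))\<^sup>2 \<le> (norm (v \<omega> - g \<omega>) + norm (g \<omega>))\<^sup>2" by (intro power_mono) auto
    also have "\<dots> \<le> 2 * (norm (v \<omega> - g \<omega>))\<^sup>2 + 2 * (norm (g \<omega>))\<^sup>2"
      using sum_squares_bound[of "norm (v \<omega> - g \<omega>)" "norm (g \<omega>)"] by (simp add: power2_sum)
    finally show ?thesis .
  qed
  then show "AE \<omega> in M. norm ((norm (v \<omega>))\<^sup>2)
      \<le> norm (2 * (norm (v \<omega> - g \<omega>))\<^sup>2 + 2 * (norm (g \<omega>))\<^sup>2)" by simp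
qed (use assms in simp)

lemma (in prob_space) sigma_finite_subalgebraI:
  assumes "subalgebra M G"
  shows "sigma_finite_subalgebra M G"
proof -
  interpret finite_measure_subalgebra M G
    using assms by (simp add: finite_measure_subalgebra_def finite_measure_subalgebra_axioms_def
        finite_measure_axioms)
  show ?thesis by (rule sigma_finite_subalgebra_axioms)
qed

text \<open>
  Pulling \<open>Z\<close> out of the conditional expectation componentwise. Square integrability of all three functions is
  what makes the products integrable.
\<close>

lemma (in prob_space) expectation_inner_noise:
  fixes v g Z :: "'a \<Rightarrow> real^'d"
  assumes G: "subalgebra M G"
    and meas: "v \<in> borel_measurable M" "g \<in> borel_measurable M" "Z \<in> borel_measurable G"
    and mean: "AE \<omega> in M. vec_cond_exp M G v \<omega> = g \<omega>"
    and int: "integrable M (\<lambda>\<omega>. (norm (v \<omega> - g \<omega>))\<^sup>2)" "integrable M (\<lambda>\<omega>. (norm (g \<omega>))\<^sup>2)"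
      "integrable M (\<lambda>\<omega>. (norm (Z \<omega>))\<^sup>2)"
  shows "integrable M (\<lambda>\<omega>. inner (v \<omega> - g \<omega>) (Z \<omega>))"
    and "(\<integral>\<omega>. inner (v \<omega> - g \<omega>) (Z \<omega>) \<partial>M) = 0"
proof -
  interpret sigma_finite_subalgebra M G using sigma_finite_subalgebraI[OF G] .
  have Z: "Z \<in> borel_measurable M" using meas(3) measurable_from_subalg[OF G] by blast
  show "integrable M (\<lambda>\<omega>. inner (v \<omega> - g \<omega>) (Z \<omega>))"
    using meas(1,2) Z int by (intro integrable_inner_of_squares borel_measurable_diff)
  have v: "integrable M (\<lambda>\<omega>. (norm (v \<omega>))\<^sup>2)" by (rule integrable_square_of_diff[OF meas(1) int(1,2)])
  have Zv: "integrable M (\<lambda>\<omega>. vec_nth (Z \<omega>) i * vec_nth (v \<omega>) i)" for i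
    by (rule integrable_inner_of_squares(2)[OF Z meas(1) int(3) v])
  have Zg: "integrable M (\<lambda>\<omega>. vec_nth (Z \<omega>) i * vec_nth (g \<omega>) i)" for i
    by (rule integrable_inner_of_squares(2)[OF Z meas(2) int(3,2)])
  have eq: "(\<integral>\<omega>. vec_nth (Z \<omega>) i * vec_nth (v \<omega>) i \<partial>M) = (\<integral>\<omega>. vec_nth (Z \<omega>) i * vec_nth (g \<omega>) i \<partial>M)" for i
  proof -
    have "(\<integral>\<omega>. vec_nth (Z \<omega>) i * vec_nth (v \<omega>) i \<partial>M)
      = (\<integral>\<omega>. vec_nth (Z \<omega>) i * real_cond_exp M G (\<lambda>\<omega>. vec_nth (v \<omega>) i) \<omega> \<partial>M)"
      using Zv[of i] by (intro real_cond_exp_intg(2)[symmetric])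
        (auto intro: borel_measurable_vec_nth meas)
    also have "\<dots> = (\<integral>\<omega>. vec_nth (Z \<omega>) i * vec_nth (g \<omega>) i \<partial>M)"
    proof (rule integral_cong_AE)
      show "AE \<omega> in M. vec_nth (Z \<omega>) i * real_cond_exp M G (\<lambda>\<omega>. vec_nth (v \<omega>) i) \<omega>
          = vec_nth (Z \<omega>) i * vec_nth (g \<omega>) i"
        using mean by eventually_elim (metis vec_cond_exp_def vec_lambda_beta)
    qed (auto intro!: borel_measurable_times borel_measurable_vec_nth Z meas borel_measurable_cond_exp2)
    finally show ?thesis .
  qed
  have "(\<integral>\<omega>. inner (v \<omega> - g \<omega>) (Z \<omega>) \<partial>M)
    = (\<integral>\<omega>. (\<Sum>i\<in>UNIV. vec_nth (Z \<omega>) i * vec_nth (v \<omega>) i - vec_nth (Z \<omega>) i * vec_nth (g \<omega>) i) \<partial>M)"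
    by (simp add: inner_vec_def right_diff_distrib mult.commute)
  also have "\<dots> = 0"
    using Zv Zg eq by (subst Bochner_Integration.integral_sum) auto
  finally show "(\<integral>\<omega>. inner (v \<omega> - g \<omega>) (Z \<omega>) \<partial>M) = 0" .
qed

text \<open>
  Conditional bounds become bounds on total expectations, and they also provide the integrability of the
  bounded quantity: the nonnegative conditional expectation is defined without it.
\<close>

lemma (in prob_space) integral_le_of_cond_exp_le:
  fixes X u :: "'a \<Rightarrow> real"
  assumes H: "subalgebra M H" and X: "X \<in> borel_measurable M" "AE \<omega> in M. 0 \<le> X \<omega>"
    and u: "integrable M u" "AE \<omega> in M. 0 \<le> u \<omega>"
    and le: "AE \<omega> in M. enn2ereal (nn_cond_exp M H (\<lambda>\<omega>. ennreal (X \<omega>)) \<omega>) \<le> ereal (u \<omega>)"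
  shows "integrable M X" and "(\<integral>\<omega>. X \<omega> \<partial>M) \<le> (\<integral>\<omega>. u \<omega> \<partial>M)"
proof -
  interpret sigma_finite_subalgebra M H using sigma_finite_subalgebraI[OF H] .
  have "(\<integral>\<^sup>+\<omega>. ennreal (X \<omega>) \<partial>M) = (\<integral>\<^sup>+\<omega>. nn_cond_exp M H (\<lambda>\<omega>. ennreal (X \<omega>)) \<omega> \<partial>M)"
    using nn_cond_exp_intg[of "\<lambda>_. 1" "\<lambda>\<omega>. ennreal (X \<omega>)"] X by simp
  also have "\<dots> \<le> (\<integral>\<^sup>+\<omega>. ennreal (u \<omega>) \<partial>M)"
  proof (rule nn_integral_mono_AE)
    show "AE \<omega> in M. nn_cond_exp M H (\<lambda>\<omega>. ennreal (X \<omega>)) \<omega> \<le> ennreal (u \<omega>)"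
      using le u(2)
    proof eventually_elim
      case (elim \<omega>)
      then show ?case by (simp add: less_eq_ennreal.rep_eq enn2ereal_ennreal)
    qed
  qed
  also have "\<dots> = ennreal (\<integral>\<omega>. u \<omega> \<partial>M)" by (rule nn_integral_eq_integral[OF u])
  finally have *: "(\<integral>\<^sup>+\<omega>. ennreal (X \<omega>) \<partial>M) \<le> ennreal (\<integral>\<omega>. u \<omega> \<partial>M)" .
  then show "integrable M X"
    using X by (intro integrableI_nonneg) (auto intro: le_less_trans)
  from nn_integral_eq_integral[OF this X(2)] * have "ennreal (\<integral>\<omega>. X \<omega> \<partial>M) \<le> ennreal (\<integral>\<omega>. u \<omega> \<partial>M)"
    by simp
  moreover have "0 \<le> (\<integral>\<omega>. u \<omega> \<partial>M)" by (rule integral_nonneg_AE[OF u(2)])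
  ultimately show "(\<integral>\<omega>. X \<omega> \<partial>M) \<le> (\<integral>\<omega>. u \<omega> \<partial>M)" by (simp add: ennreal_le_iff)
qed

section \<open>Descent of one step and its expectation\<close>

locale composite_problem =
  fixes f :: "real^'d \<Rightarrow> real" and h :: "real^'d \<Rightarrow> ereal" and xs :: "real^'d" and \<mu> L :: real
  assumes f_smooth: "twice_cont_differentiable f"
    and mu_pos: "0 < \<mu>" and L_pos: "0 < L"
    and hessian: "\<And>z. \<mu> *\<^sub>R mat 1 \<preceq>\<^sub>L hess f z" "\<And>z. hess f z \<preceq>\<^sub>L L *\<^sub>R mat 1"
    and proper: "proper_fun h" and conv: "ereal_convex h" and lsc: "lower_semicont h"
    and minimizer: "is_arg_min (\<lambda>z. ereal (f z) + h z) (\<lambda>_. True) xs"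
begin

lemmas strong_convexity = quadratic_bounds(1)[OF f_smooth hessian]
lemmas descent = quadratic_bounds(2)[OF f_smooth hessian]

lemma gradient_inequality: "f x + inner (grad f x) (y - x) \<le> f y"
  using strong_convexity[of x y] mu_pos
  by (smt (verit) mult_nonneg_nonneg zero_le_power2 divide_nonneg_pos)

lemma grad_lipschitz: "norm (grad f x - grad f y) \<le> L * norm (x - y)"
  using L_pos gradient_inequality descent by (rule gradient_lipschitz)

lemma continuous_f: "continuous_on UNIV f" and continuous_grad: "continuous_on UNIV (grad f)"
  using f_smooth unfolding twice_cont_differentiable_def
  by (auto intro!: continuous_at_imp_continuous_on differentiable_imp_continuous_within)

lemma h_not_minf: "h z \<noteq> -\<infinity>"
  using proper unfolding proper_fun_def by blast

lemma minimizer_optimality: "h xs \<noteq> \<infinity>" "h xs \<le> h z + ereal (inner (grad f xs) (z - xs))"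
proof -
  have "f (xs + t *\<^sub>R d) \<le> f xs + t * inner (grad f xs) d + t\<^sup>2 * (L / 2 * (norm d)\<^sup>2)" for d t
    using descent[of "xs + t *\<^sub>R d" xs] by (simp add: power_mult_distrib mult.left_commute)
  from variational_inequality[OF proper conv minimizer this]
  show "h xs \<noteq> \<infinity>" "h xs \<le> h z + ereal (inner (grad f xs) (z - xs))" by blast+
qed

definition hs :: real where "hs = real_of_ereal (h xs)"

lemma h_xs: "h xs = ereal hs"
  using minimizer_optimality(1) h_not_minf unfolding hs_def by (cases "h xs") auto

text \<open>
  Optimality of \<open>xs\<close> for \<open>F\<close> says that \<open>- \<nabla>f(xs)\<close> is a subgradient of \<open>h\<close>, which supplies the minorant that
  makes all proximal subproblems solvable.
\<close>

lemma affine_minorant: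
  "ereal ((hs + inner (grad f xs) xs) + inner (- grad f xs) z) \<le> h z"
  using minimizer_optimality(2)[of z] unfolding h_xs
  by (cases "h z") (auto simp: inner_diff_right)

text \<open>
  The real number \<open>F z - F xs\<close>; where \<open>F z = \<infinity>\<close> it takes the default value \<open>0\<close>, so that it is nonnegative
  everywhere.
\<close>

definition gap :: "real^'d \<Rightarrow> real" where
  "gap z = real_of_ereal (ereal (f z) + h z - (ereal (f xs) + h xs))"

lemma gap_eq: "h z = ereal hz \<Longrightarrow> gap z = (f z + hz) - (f xs + hs)"
  unfolding gap_def h_xs by simp

lemma ereal_gap:
  assumes "h z \<noteq> \<infinity>"
  shows "ereal (f z) + h z - (ereal (f xs) + h xs) = ereal (gap z)"
proof -
  obtain hz where "h z = ereal hz" using assms h_not_minf by (metis ereal_cases)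
  then show ?thesis using gap_eq[of z hz] by (simp add: h_xs)
qed

lemma gap_nonneg: "0 \<le> gap z"
proof (cases "h z = \<infinity>")
  case True
  then show ?thesis unfolding gap_def h_xs by simp
next
  case False
  then obtain hz where hz: "h z = ereal hz" using h_not_minf by (metis ereal_cases)
  have "ereal (f xs) + h xs \<le> ereal (f z) + h z"
    using minimizer unfolding is_arg_min_def by (auto simp: not_less)
  then show ?thesis using gap_eq[OF hz] by (simp add: hz h_xs)
qed

lemma borel_measurable_gap: "gap \<in> borel_measurable borel"
proof -
  have "f \<in> borel_measurable borel" using continuous_f by (rule borel_measurable_continuous_onI)
  moreover have "h \<in> borel_measurable borel" using lsc by (rule borel_measurable_lower_semicont)
  ultimately show ?thesis unfolding gap_def[abs_def] by measurable
qed

end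

locale prox_metric = composite_problem f h xs \<mu> L
  for f :: "real^'d \<Rightarrow> real" and h :: "real^'d \<Rightarrow> ereal" and xs :: "real^'d" and \<mu> L :: real +
  fixes \<eta> m1 m2 :: real
  assumes m1_pos: "0 < m1" and m2_pos: "0 < m2" and eta_pos: "0 < \<eta>" and step: "\<eta> * L \<le> m1"
begin

definition admissible :: "real^'d^'d \<Rightarrow> bool" where
  "admissible B \<longleftrightarrow> m1 *\<^sub>R mat 1 \<preceq>\<^sub>L B \<and> B \<preceq>\<^sub>L m2 *\<^sub>R mat 1"

abbreviation sqdist :: "real^'d^'d \<Rightarrow> real^'d \<Rightarrow> real" where
  "sqdist B x \<equiv> inner (x - xs) (B *v (x - xs))"

lemma sqdist_bounds:
  assumes "admissible B"
  shows "m1 * (norm (x - xs))\<^sup>2 \<le> sqdist B x" "sqdist B x \<le> m2 * (norm (x - xs))\<^sup>2"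
    "0 \<le> sqdist B x"
proof -
  show 1: "m1 * (norm (x - xs))\<^sup>2 \<le> sqdist B x" "sqdist B x \<le> m2 * (norm (x - xs))\<^sup>2"
    using loewner_leD(1,2)[of m1 B m2] assms unfolding admissible_def by auto
  have "0 \<le> m1 * (norm (x - xs))\<^sup>2" using m1_pos by simp
  with 1(1) show "0 \<le> sqdist B x" by linarith
qed

lemma exact_step:
  assumes "admissible B"
  shows "is_arg_min (prox_objective \<eta> h B x g) (\<lambda>_. True) (prox_step \<eta> h B x g)"
  using assms unfolding admissible_def
  by (intro prox_step_exists[OF proper lsc affine_minorant _ _ m1_pos eta_pos]) auto

lemma step_descent:
  assumes B: "admissible B" and p: "is_arg_min (prox_objective \<eta> h B x g) (\<lambda>_. True) p"
  shows "h p \<noteq> \<infinity>"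
    and "sqdist B p + 2 * \<eta> * gap p
      \<le> (1 - \<eta> * \<mu> / m2) * sqdist B x - 2 * \<eta> * inner (g - grad f x) (p - xs)"
proof -
  note B' = B[unfolded admissible_def, THEN conjunct1] B[unfolded admissible_def, THEN conjunct2]
  show fin: "h p \<noteq> \<infinity>" by (rule prox_variational(1)[OF proper conv B' m1_pos eta_pos p])
  then obtain hp where hp: "h p = ereal hp" using h_not_minf by (metis ereal_cases)
  show "sqdist B p + 2 * \<eta> * gap p
      \<le> (1 - \<eta> * \<mu> / m2) * sqdist B x - 2 * \<eta> * inner (g - grad f x) (p - xs)"
    unfolding gap_eq[OF hp]
    using prox_descent[OF proper conv B' m1_pos m2_pos eta_pos _ step strong_convexity descent p hp h_xs]
      mu_pos by simp
qed

text \<open>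
  With the exact gradient there is no noise term, so the step does not increase the distance to the
  minimiser. Hence the exact step is square integrable relative to \<open>xs\<close> whenever \<open>x\<close> is.
\<close>

lemma exact_step_distance:
  assumes B: "admissible B"
  shows "m1 * (norm (prox_step \<eta> h B x (grad f x) - xs))\<^sup>2 \<le> sqdist B x"
proof -
  let ?p = "prox_step \<eta> h B x (grad f x)"
  have "m1 * (norm (?p - xs))\<^sup>2 \<le> sqdist B ?p" by (rule sqdist_bounds(1)[OF B])
  also have "\<dots> \<le> (1 - \<eta> * \<mu> / m2) * sqdist B x"
    using step_descent(2)[OF B exact_step[OF B], of x "grad f x"] gap_nonneg[of ?p] eta_pos
    by (smt (verit) diff_self inner_zero_left mult_nonneg_nonneg mult_zero_right)
  also have "\<dots> \<le> 1 * sqdist B x"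
    using sqdist_bounds(3)[OF B] eta_pos mu_pos m2_pos by (intro mult_right_mono) auto
  finally show ?thesis by simp
qed

text \<open>
  The noise term is split at the step with the exact gradient, from which the actual step differs by at most
  \<open>\<eta> / m1\<close> times the gradient error.
\<close>

lemma noisy_step_descent:
  assumes B: "admissible B" and p: "is_arg_min (prox_objective \<eta> h B x g) (\<lambda>_. True) p"
  shows "sqdist B p + 2 * \<eta> * gap p
      \<le> (1 - \<eta> * \<mu> / m2) * sqdist B x + 2 * \<eta>\<^sup>2 / m1 * (norm (g - grad f x))\<^sup>2
        - 2 * \<eta> * inner (g - grad f x) (prox_step \<eta> h B x (grad f x) - xs)"
proof -
  let ?q = "prox_step \<eta> h B x (grad f x)"
  let ?e = "g - grad f x"
  note B' = B[unfolded admissible_def, THEN conjunct1] B[unfolded admissible_def, THEN conjunct2]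
  have "m1 * norm (p - ?q) \<le> norm (\<eta> *\<^sub>R ?e)"
    using prox_stability[OF proper conv B' B' m1_pos eta_pos p exact_step[OF B, of x "grad f x"]] eta_pos
    by (simp add: scaleR_right_diff_distrib)
  also have "\<dots> = \<eta> * norm ?e" using eta_pos by (simp only: norm_scaleR abs_of_pos)
  finally have "norm (p - ?q) \<le> \<eta> / m1 * norm ?e" using m1_pos eta_pos by (simp add: field_simps)
  then have "norm ?e * norm (p - ?q) \<le> norm ?e * (\<eta> / m1 * norm ?e)" by (intro mult_left_mono) auto
  moreover have "- inner ?e (p - ?q) \<le> norm ?e * norm (p - ?q)"
    using Cauchy_Schwarz_ineq2[of ?e "p - ?q"] by linarith
  ultimately have "- inner ?e (p - ?q) \<le> \<eta> / m1 * (norm ?e)\<^sup>2"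
    by (simp add: power2_eq_square mult.left_commute)
  then have "2 * \<eta> * (- inner ?e (p - ?q)) \<le> 2 * \<eta> * (\<eta> / m1 * (norm ?e)\<^sup>2)"
    using eta_pos by (intro mult_left_mono) auto
  moreover have "2 * \<eta> * (\<eta> / m1 * (norm ?e)\<^sup>2) = 2 * \<eta>\<^sup>2 / m1 * (norm ?e)\<^sup>2"
    by (simp add: power2_eq_square)
  moreover have "2 * \<eta> * inner ?e (p - xs) = 2 * \<eta> * inner ?e (p - ?q) + 2 * \<eta> * inner ?e (?q - xs)"
    by (simp add: inner_diff_right right_diff_distrib)
  ultimately show ?thesis using step_descent(2)[OF B p] by linarith
qed

text \<open>
  The metric and the centre belong to the past \<open>G\<close>, so the exact step does too, and the linear noise term
  disappears in the mean.
\<close>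

lemma expected_descent:
  fixes M :: "'w measure" and X v p :: "'w \<Rightarrow> real^'d" and B :: "'w \<Rightarrow> real^'d^'d"
  assumes "prob_space M" and G: "subalgebra M G"
    and meas: "X \<in> borel_measurable G" "B \<in> borel_measurable G"
      "v \<in> borel_measurable M" "p \<in> borel_measurable M"
    and adm: "AE \<omega> in M. admissible (B \<omega>)"
    and step: "AE \<omega> in M. is_arg_min (prox_objective \<eta> h (B \<omega>) (X \<omega>) (v \<omega>)) (\<lambda>_. True) (p \<omega>)"
    and mean: "AE \<omega> in M. vec_cond_exp M G v \<omega> = grad f (X \<omega>)"
    and int_X: "integrable M (\<lambda>\<omega>. sqdist (B \<omega>) (X \<omega>))"
    and int_v: "integrable M (\<lambda>\<omega>. (norm (v \<omega> - grad f (X \<omega>)))\<^sup>2)"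
  shows "integrable M (\<lambda>\<omega>. sqdist (B \<omega>) (p \<omega>))" "integrable M (\<lambda>\<omega>. gap (p \<omega>))"
    and "(\<integral>\<omega>. sqdist (B \<omega>) (p \<omega>) \<partial>M) + 2 * \<eta> * (\<integral>\<omega>. gap (p \<omega>) \<partial>M)
      \<le> (1 - \<eta> * \<mu> / m2) * (\<integral>\<omega>. sqdist (B \<omega>) (X \<omega>) \<partial>M)
        + 2 * \<eta>\<^sup>2 / m1 * (\<integral>\<omega>. (norm (v \<omega> - grad f (X \<omega>)))\<^sup>2 \<partial>M)"
proof -
  interpret prob_space M by fact
  have grad_meas: "(\<lambda>\<omega>. grad f (X \<omega>)) \<in> borel_measurable N" if "X \<in> borel_measurable N" for N :: "'w measure"
    using continuous_grad that by (rule borel_measurable_continuous_on)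
  have MX: "X \<in> borel_measurable M" and MB: "B \<in> borel_measurable M"
    using meas(1,2) measurable_from_subalg[OF G] by blast+
  \<comment> \<open>The exact step relative to \<open>xs\<close>; the default value concerns a null set only.\<close>
  define Z where "Z \<omega> = (if admissible (B \<omega>) then prox_step \<eta> h (B \<omega>) (X \<omega>) (grad f (X \<omega>)) else 0) - xs" for \<omega>
  have Z: "Z \<in> borel_measurable G"
    unfolding Z_def[abs_def] admissible_def
    by (intro borel_measurable_diff borel_measurable_const grad_meas meas
        borel_measurable_prox_step[OF proper conv lsc affine_minorant m1_pos eta_pos])
  then have MZ: "Z \<in> borel_measurable M" using measurable_from_subalg[OF G] by blast
  have int_Z: "integrable M (\<lambda>\<omega>. (norm (Z \<omega>))\<^sup>2)"
  proof (rule Bochner_Integration.integrable_bound)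
    show "integrable M (\<lambda>\<omega>. 1 / m1 * sqdist (B \<omega>) (X \<omega>))" using int_X by (rule integrable_mult_right)
    show "AE \<omega> in M. norm ((norm (Z \<omega>))\<^sup>2) \<le> norm (1 / m1 * sqdist (B \<omega>) (X \<omega>))"
      using adm
    proof eventually_elim
      case (elim \<omega>)
      have "m1 * (norm (Z \<omega>))\<^sup>2 \<le> sqdist (B \<omega>) (X \<omega>)"
        using exact_step_distance[OF elim, of "X \<omega>"] elim unfolding Z_def by simp
      then have "(norm (Z \<omega>))\<^sup>2 \<le> 1 / m1 * sqdist (B \<omega>) (X \<omega>)" using m1_pos by (simp add: field_simps)
      then show ?case by (simp only: real_norm_def abs_power2)
    qed
  qed (use MZ in simp)
  have int_d: "integrable M (\<lambda>\<omega>. (norm (X \<omega> - xs))\<^sup>2)"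
  proof (rule Bochner_Integration.integrable_bound)
    show "integrable M (\<lambda>\<omega>. 1 / m1 * sqdist (B \<omega>) (X \<omega>))" using int_X by (rule integrable_mult_right)
    show "AE \<omega> in M. norm ((norm (X \<omega> - xs))\<^sup>2) \<le> norm (1 / m1 * sqdist (B \<omega>) (X \<omega>))"
      using adm
    proof eventually_elim
      case (elim \<omega>)
      have "(norm (X \<omega> - xs))\<^sup>2 \<le> 1 / m1 * sqdist (B \<omega>) (X \<omega>)"
        using sqdist_bounds(1)[OF elim, of "X \<omega>"] m1_pos by (simp add: field_simps)
      then show ?case by (simp only: real_norm_def abs_power2)
    qed
  qed (use MX in simp)
  have int_g: "integrable M (\<lambda>\<omega>. (norm (grad f (X \<omega>)))\<^sup>2)"
  proof (rule integrable_square_of_diff[where g = "\<lambda>_. grad f xs"])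
    show "integrable M (\<lambda>\<omega>. (norm (grad f (X \<omega>) - grad f xs))\<^sup>2)"
    proof (rule Bochner_Integration.integrable_bound)
      show "integrable M (\<lambda>\<omega>. L\<^sup>2 * (norm (X \<omega> - xs))\<^sup>2)" using int_d by (rule integrable_mult_right)
      have "(norm (grad f (X \<omega>) - grad f xs))\<^sup>2 \<le> (L * norm (X \<omega> - xs))\<^sup>2" for \<omega>
        by (intro power_mono grad_lipschitz) simp
      then show "AE \<omega> in M. norm ((norm (grad f (X \<omega>) - grad f xs))\<^sup>2) \<le> norm (L\<^sup>2 * (norm (X \<omega> - xs))\<^sup>2)"
        by (simp add: power_mult_distrib)
    qed (use grad_meas[OF MX] in simp)
  qed (use grad_meas[OF MX] in auto)
  note noise = expectation_inner_noise[OF G meas(3) grad_meas[OF MX] Z mean int_v int_g int_Z]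
  define R where "R \<omega> = (1 - \<eta> * \<mu> / m2) * sqdist (B \<omega>) (X \<omega>)
      + 2 * \<eta>\<^sup>2 / m1 * (norm (v \<omega> - grad f (X \<omega>)))\<^sup>2
      - 2 * \<eta> * inner (v \<omega> - grad f (X \<omega>)) (Z \<omega>)" for \<omega>
  have int_R: "integrable M R"
    unfolding R_def[abs_def]
    by (intro Bochner_Integration.integrable_diff Bochner_Integration.integrable_add
        integrable_mult_right int_X int_v noise(1))
  have ER: "(\<integral>\<omega>. R \<omega> \<partial>M) = (1 - \<eta> * \<mu> / m2) * (\<integral>\<omega>. sqdist (B \<omega>) (X \<omega>) \<partial>M)
        + 2 * \<eta>\<^sup>2 / m1 * (\<integral>\<omega>. (norm (v \<omega> - grad f (X \<omega>)))\<^sup>2 \<partial>M)"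
  proof -
    have "(\<integral>\<omega>. R \<omega> \<partial>M) = (\<integral>\<omega>. (1 - \<eta> * \<mu> / m2) * sqdist (B \<omega>) (X \<omega>)
        + 2 * \<eta>\<^sup>2 / m1 * (norm (v \<omega> - grad f (X \<omega>)))\<^sup>2 \<partial>M)
      - (\<integral>\<omega>. 2 * \<eta> * inner (v \<omega> - grad f (X \<omega>)) (Z \<omega>) \<partial>M)"
      unfolding R_def by (intro Bochner_Integration.integral_diff Bochner_Integration.integrable_add
        integrable_mult_right int_X int_v noise(1))
    also have "(\<integral>\<omega>. 2 * \<eta> * inner (v \<omega> - grad f (X \<omega>)) (Z \<omega>) \<partial>M) = 0"
      using noise(2) by (subst integral_mult_right_zero) simp
    also have "(\<integral>\<omega>. (1 - \<eta> * \<mu> / m2) * sqdist (B \<omega>) (X \<omega>)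
        + 2 * \<eta>\<^sup>2 / m1 * (norm (v \<omega> - grad f (X \<omega>)))\<^sup>2 \<partial>M)
      = (\<integral>\<omega>. (1 - \<eta> * \<mu> / m2) * sqdist (B \<omega>) (X \<omega>) \<partial>M)
        + (\<integral>\<omega>. 2 * \<eta>\<^sup>2 / m1 * (norm (v \<omega> - grad f (X \<omega>)))\<^sup>2 \<partial>M)"
      by (intro Bochner_Integration.integral_add integrable_mult_right int_X int_v)
    finally show ?thesis by (simp only: integral_mult_right_zero diff_zero)
  qed
  have le_R: "AE \<omega> in M. sqdist (B \<omega>) (p \<omega>) + 2 * \<eta> * gap (p \<omega>) \<le> R \<omega>"
    using adm step
  proof eventually_elim
    case (elim \<omega>)
    then show ?case using noisy_step_descent[OF elim] unfolding R_def Z_def by simp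
  qed
  have Mgap: "(\<lambda>\<omega>. gap (p \<omega>)) \<in> borel_measurable M"
    using meas(4) borel_measurable_gap by (rule measurable_compose)
  have Msq: "(\<lambda>\<omega>. sqdist (B \<omega>) (p \<omega>)) \<in> borel_measurable M"
    using meas(4) MB by (intro borel_measurable_inner borel_measurable_matrix_vector_mult
        borel_measurable_diff borel_measurable_const)
  show int1: "integrable M (\<lambda>\<omega>. sqdist (B \<omega>) (p \<omega>))"
  proof (rule Bochner_Integration.integrable_bound[OF int_R Msq])
    show "AE \<omega> in M. norm (sqdist (B \<omega>) (p \<omega>)) \<le> norm (R \<omega>)"
      using le_R adm
    proof eventually_elim
      case (elim \<omega>)
      have "0 \<le> 2 * \<eta> * gap (p \<omega>)" using gap_nonneg eta_pos by simp
      then show ?case using elim(1) sqdist_bounds(3)[OF elim(2), of "p \<omega>"] by simp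
    qed
  qed
  have int2: "integrable M (\<lambda>\<omega>. 2 * \<eta> * gap (p \<omega>))"
  proof (rule Bochner_Integration.integrable_bound[OF int_R])
    show "AE \<omega> in M. norm (2 * \<eta> * gap (p \<omega>)) \<le> norm (R \<omega>)"
      using le_R adm
    proof eventually_elim
      case (elim \<omega>)
      have "0 \<le> 2 * \<eta> * gap (p \<omega>)" using gap_nonneg eta_pos by simp
      then show ?case using elim(1) sqdist_bounds(3)[OF elim(2), of "p \<omega>"] by (simp only: real_norm_def)
    qed
  qed (use Mgap in simp)
  then show "integrable M (\<lambda>\<omega>. gap (p \<omega>))" using eta_pos by simp
  have "(\<integral>\<omega>. sqdist (B \<omega>) (p \<omega>) \<partial>M) + 2 * \<eta> * (\<integral>\<omega>. gap (p \<omega>) \<partial>M)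
    = (\<integral>\<omega>. sqdist (B \<omega>) (p \<omega>) + 2 * \<eta> * gap (p \<omega>) \<partial>M)"
    using int1 int2 by (subst Bochner_Integration.integral_add) auto
  also have "\<dots> \<le> (\<integral>\<omega>. R \<omega> \<partial>M)"
    by (intro integral_mono_AE Bochner_Integration.integrable_add int1 int2 int_R le_R)
  finally show "(\<integral>\<omega>. sqdist (B \<omega>) (p \<omega>) \<partial>M) + 2 * \<eta> * (\<integral>\<omega>. gap (p \<omega>) \<partial>M)
      \<le> (1 - \<eta> * \<mu> / m2) * (\<integral>\<omega>. sqdist (B \<omega>) (X \<omega>) \<partial>M)
        + 2 * \<eta>\<^sup>2 / m1 * (\<integral>\<omega>. (norm (v \<omega> - grad f (X \<omega>)))\<^sup>2 \<partial>M)"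
    unfolding ER .
qed

end

section \<open>The linear rate\<close>

text \<open>
  The number of metric changes is \<open>\<lfloor>k/r\<rfloor> \<le> k/r\<close>, and the last factor on the right is at least \<open>1\<close> because
  \<open>\<kappa> \<rho>\<^sup>r\<close> is the \<open>r\<close>-th power of a number below \<open>1\<close>.
\<close>

lemma geometric_rate_bound:
  fixes \<kappa> \<rho> :: real
  assumes "1 \<le> \<kappa>" "0 < \<rho>" "0 < r" and "\<kappa> powr (1 / real r) * \<rho> < 1"
  shows "\<kappa> ^ (k div r) * \<rho> ^ k \<le> (\<kappa> powr (1 / real r) * \<rho>) ^ k * inverse (\<kappa> * \<rho> ^ r)"
proof -
  let ?q = "\<kappa> powr (1 / real r)"
  have q: "?q ^ r = \<kappa>" "1 \<le> ?q"
    using assms by (simp_all add: powr_power ge_one_powr_ge_zero)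
  have "\<kappa> ^ (k div r) = ?q ^ (r * (k div r))" by (simp only: power_mult q(1))
  also have "\<dots> \<le> ?q ^ k" by (rule power_increasing[OF _ q(2)]) simp
  finally have "\<kappa> ^ (k div r) * \<rho> ^ k \<le> ?q ^ k * \<rho> ^ k" using assms(2) by (intro mult_right_mono) auto
  also have "\<dots> = (?q * \<rho>) ^ k" by (simp add: power_mult_distrib)
  also have "\<dots> \<le> (?q * \<rho>) ^ k * inverse (\<kappa> * \<rho> ^ r)"
  proof -
    have "(?q * \<rho>) ^ r \<le> 1" using assms(2,4) by (intro power_le_one) auto
    then have "\<kappa> * \<rho> ^ r \<le> 1" by (simp add: power_mult_distrib q(1))
    moreover have "0 < \<kappa> * \<rho> ^ r" using assms(1,2) by simp
    ultimately have "1 \<le> inverse (\<kappa> * \<rho> ^ r)" by (rule one_le_inverse[rotated])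
    moreover have "0 \<le> (?q * \<rho>) ^ k" using assms(2) by simp
    ultimately show ?thesis by (metis mult.right_neutral mult_left_mono)
  qed
  finally show ?thesis .
qed

text \<open>
  The noise enters with the factor \<open>2/m1\<close>, whereas the step size conditions contain \<open>2 m2/m1\<^sup>2\<close>; the latter is
  at least as large since \<open>m1 \<le> m2\<close>. The three terms are then compared separately: \<open>q\<close> by the first condition on \<open>\<rho>\<close>, \<open>z\<close> by
  the second, and \<open>d\<close> by the bound on the step size.
\<close>

lemma lyapunov_contraction:
  fixes q d z e q' d' z' :: real
  assumes descent: "q' + 2 * \<eta> * d' \<le> (1 - \<eta> * \<mu> / m2) * q + 2 * \<eta>\<^sup>2 / m1 * e"
    and var: "e \<le> a * d + b * z" and rec: "z' \<le> (1 - \<gamma>) * z + c * d"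
    and nonneg: "0 \<le> q" "0 \<le> d" "0 \<le> z" "0 \<le> a" "0 \<le> b"
    and pos: "0 < \<eta>" "0 < A" "0 < m1" "m1 \<le> m2"
    and rho: "1 - \<eta> * \<mu> / m2 \<le> \<rho>" "2 * m2 * b / (m1\<^sup>2 * A) + 1 - \<gamma> \<le> \<rho>"
    and step: "(2 * m2 * a / m1\<^sup>2 + A * c) * \<eta> \<le> 2 * \<rho>"
  shows "q' + A * \<eta>\<^sup>2 * z' + 2 * \<eta> * d' \<le> \<rho> * (q + A * \<eta>\<^sup>2 * z + 2 * \<eta> * d)"
proof -
  have ratio: "2 / m1 * w \<le> 2 * m2 * w / m1\<^sup>2" if "0 \<le> w" for w
  proof -
    have "2 / m1 * w = 2 * m1 * w / m1\<^sup>2" using pos by (simp add: power2_eq_square)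
    also have "\<dots> \<le> 2 * m2 * w / m1\<^sup>2"
      using pos that by (intro divide_right_mono mult_right_mono) auto
    finally show ?thesis .
  qed
  have "2 * m2 * b / m1\<^sup>2 = A * (2 * m2 * b / (m1\<^sup>2 * A))" using pos by simp
  also have "\<dots> \<le> A * (\<rho> - 1 + \<gamma>)" using rho(2) pos by (intro mult_left_mono) auto
  finally have "2 / m1 * b + A * (1 - \<gamma>) \<le> A * \<rho>" using ratio[OF nonneg(5)] by (simp add: algebra_simps)
  then have tz: "\<eta>\<^sup>2 * z * (2 / m1 * b + A * (1 - \<gamma>)) \<le> \<eta>\<^sup>2 * z * (A * \<rho>)"
    using nonneg by (intro mult_left_mono) auto
  have "(2 / m1 * a + A * c) * \<eta> \<le> (2 * m2 * a / m1\<^sup>2 + A * c) * \<eta>"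
    using ratio[OF nonneg(4)] pos by (intro mult_right_mono) auto
  with step have "(2 / m1 * a + A * c) * \<eta> \<le> 2 * \<rho>" by linarith
  then have td: "\<eta> * d * ((2 / m1 * a + A * c) * \<eta>) \<le> \<eta> * d * (2 * \<rho>)"
    using nonneg pos by (intro mult_left_mono) auto
  have tq: "(1 - \<eta> * \<mu> / m2) * q \<le> \<rho> * q" using rho(1) nonneg by (intro mult_right_mono) auto
  have "2 * \<eta>\<^sup>2 / m1 * e \<le> 2 * \<eta>\<^sup>2 / m1 * (a * d + b * z)"
    using var pos by (intro mult_left_mono) auto
  moreover have "A * \<eta>\<^sup>2 * z' \<le> A * \<eta>\<^sup>2 * ((1 - \<gamma>) * z + c * d)"
    using rec pos by (intro mult_left_mono) auto
  moreover have "2 * \<eta>\<^sup>2 / m1 * (a * d + b * z) + A * \<eta>\<^sup>2 * ((1 - \<gamma>) * z + c * d)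
    = \<eta>\<^sup>2 * z * (2 / m1 * b + A * (1 - \<gamma>)) + \<eta> * d * ((2 / m1 * a + A * c) * \<eta>)"
    by (simp add: algebra_simps power2_eq_square add_divide_distrib)
  ultimately have "q' + A * \<eta>\<^sup>2 * z' + 2 * \<eta> * d'
    \<le> \<rho> * q + \<eta>\<^sup>2 * z * (A * \<rho>) + \<eta> * d * (2 * \<rho>)"
    using descent tq tz td by linarith
  also have "\<dots> = \<rho> * (q + A * \<eta>\<^sup>2 * z + 2 * \<eta> * d)" by (simp add: algebra_simps)
  finally show ?thesis .
qed

theorem theorem4p10:
  fixes M :: "'w measure" and P :: "'p measure"
    and n :: nat and f :: "nat \<Rightarrow> real^'d \<Rightarrow> real" and h :: "real^'d \<Rightarrow> ereal"
    and r l :: nat and mem :: "nat \<Rightarrow> nat"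
    and x0 xs :: "real^'d" and \<phi>0 :: 'p
    and S :: "nat \<Rightarrow> 'w \<Rightarrow> nat set" and \<phi> :: "nat \<Rightarrow> 'w \<Rightarrow> 'p"
    and v x :: "nat \<Rightarrow> 'w \<Rightarrow> real^'d" and B :: "nat \<Rightarrow> 'w \<Rightarrow> real^'d^'d"
    and \<xi> :: "nat \<Rightarrow> 'w \<Rightarrow> real" and \<xi>0 :: real
    and \<mu> L \<eta> a b c \<gamma> A \<rho> m1 m2 :: real
    and F :: "real^'d \<Rightarrow> ereal" and V :: "nat \<Rightarrow> 'w \<Rightarrow> ereal"
  assumes n_pos: "1 \<le> n"
    and smooth: "\<And>i. i \<in> {1..n} \<Longrightarrow> twice_cont_differentiable (f i)"
    and "0 < \<mu>" and "0 < L"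
    and hessian_bounds: "\<And>T z. T \<subseteq> {1..n} \<Longrightarrow> T \<noteq> {} \<Longrightarrow>
        \<mu> *\<^sub>R mat 1 \<preceq>\<^sub>L hess (subsample_avg f T) z \<and> hess (subsample_avg f T) z \<preceq>\<^sub>L L *\<^sub>R mat 1"
    and "proper_fun h" and "ereal_convex h" and "lower_semicont h"
    and F_eq: "\<And>z. F z = ereal (subsample_avg f {1..n} z) + h z"
    and minimizer: "is_arg_min F (\<lambda>_. True) xs"
    and minimizer_unique: "\<And>z. is_arg_min F (\<lambda>_. True) z \<Longrightarrow> z = xs"
    and algorithm:
      "stochastic_prox_quasi_newton M P n f h (\<lambda>_. \<eta>) r l mem x0 \<phi>0 S \<phi> v x B"
    and unbiased: "\<And>k. AE \<omega> in M.
        vec_cond_exp M (history M P x \<phi> k) (v k) \<omega> = grad (subsample_avg f {1..n}) (x k \<omega>)"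
    and "0 \<le> a" and "0 \<le> b" and "0 \<le> c" and "0 < \<gamma>" and "\<gamma> \<le> 1"
    and xi_measurable: "\<And>k. \<xi> k \<in> borel_measurable M"
    and xi_nonneg: "\<And>k. AE \<omega> in M. 0 \<le> \<xi> k \<omega>"
    and xi_initial: "\<And>\<omega>. \<omega> \<in> space M \<Longrightarrow> \<xi> 0 \<omega> = \<xi>0"
    and variance: "\<And>k. AE \<omega> in M.
        enn2ereal (nn_cond_exp M (history M P x \<phi> k)
          (\<lambda>\<omega>. ennreal ((norm (v k \<omega> - grad (subsample_avg f {1..n}) (x k \<omega>)))\<^sup>2)) \<omega>)
        \<le> ereal a * (F (x k \<omega>) - F xs) + ereal (b * \<xi> k \<omega>)"
    and xi_recursion: "\<And>k. AE \<omega> in M.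
        enn2ereal (nn_cond_exp M (history M P x \<phi> k) (\<lambda>\<omega>. ennreal (\<xi> (Suc k) \<omega>)) \<omega>)
        \<le> ereal ((1 - \<gamma>) * \<xi> k \<omega>) + ereal c * (F (x k \<omega>) - F xs)"
    and "0 < m1" and "0 < m2"
    and metric_bounds: "AE \<omega> in M. \<forall>k. m1 *\<^sub>R mat 1 \<preceq>\<^sub>L B k \<omega> \<and> B k \<omega> \<preceq>\<^sub>L m2 *\<^sub>R mat 1"
    and "0 < A" and "0 < \<eta>"
    and step_size_bound: "\<eta> * L \<le> m1"
    and rho_eq: "\<rho> = max (1 - \<eta> * \<mu> / m2) (2 * m2 * b / (m1\<^sup>2 * A) + 1 - \<gamma>)"
    and "0 < \<rho>" and "\<rho> < 1"
    and "(2 * m2 * a / m1\<^sup>2 + A * c) * \<eta> \<le> 2 * \<rho>"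
    and "(m2 / m1) powr (1 / real r) * \<rho> < 1"
    and V_eq: "\<And>k \<omega>. V k \<omega> =
        ereal ((matrix_norm (B k \<omega>) (x k \<omega> - xs))\<^sup>2) + ereal (A * \<eta>\<^sup>2 * \<xi> k \<omega>)
        + ereal (2 * \<eta>) * (F (x k \<omega>) - F xs)"
  shows "\<forall>k\<ge>r. \<forall>\<omega>0\<in>space M.
      enn2ereal (\<integral>\<^sup>+ \<omega>. e2ennreal (V k \<omega>) \<partial>M)
      \<le> ereal (((m2 / m1) powr (1 / real r) * \<rho>) ^ k * inverse (m2 / m1 * \<rho> ^ r)) * V 0 \<omega>0"
proof -
  let ?f = "subsample_avg f {1..n}"
  interpret stochastic_prox_quasi_newton M P n f h "\<lambda>_. \<eta>" r l mem x0 \<phi>0 S \<phi> v x B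
    by (rule algorithm)
  interpret prox_metric ?f h xs \<mu> L \<eta> m1 m2
  proof unfold_locales
    show "twice_cont_differentiable ?f" using smooth by (rule twice_cont_differentiable_subsample_avg)
    show "\<mu> *\<^sub>R mat 1 \<preceq>\<^sub>L hess ?f z" "hess ?f z \<preceq>\<^sub>L L *\<^sub>R mat 1" for z
      using hessian_bounds[of "{1..n}" z] n_pos by auto
    show "is_arg_min (\<lambda>z. ereal (?f z) + h z) (\<lambda>_. True) xs"
      using minimizer unfolding F_eq[abs_def] .
  qed fact+
  let ?\<kappa> = "m2 / m1"
  have adm: "AE \<omega> in M. admissible (B k \<omega>)" for k
    using metric_bounds by eventually_elim (auto simp: admissible_def)
  \<comment> \<open>An admissible metric exists almost surely, and the space has a nonzero vector.\<close>
  have "m1 \<le> m2"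
  proof -
    obtain \<omega> where "admissible (B 0 \<omega>)"
      using eventually_happens'[OF ae_filter_bot adm[of 0]] by blast
    from sqdist_bounds(1,2)[OF this, of "xs + axis undefined 1"]
    show ?thesis by simp
  qed
  then have kappa: "1 \<le> ?\<kappa>" using m1_pos by simp
  have F_gap: "F z - F xs = ereal (gap z)" if "h z \<noteq> \<infinity>" for z
    using ereal_gap[OF that] unfolding F_eq .
  define Q where "Q k \<omega> = sqdist (B k \<omega>) (x k \<omega>)" for k \<omega>
  define D where "D k \<omega> = gap (x k \<omega>)" for k \<omega>
  have V_real: "V k \<omega> = ereal (Q k \<omega> + A * \<eta>\<^sup>2 * \<xi> k \<omega> + 2 * \<eta> * D k \<omega>)"
    if "admissible (B k \<omega>)" "h (x k \<omega>) \<noteq> \<infinity>" for k \<omega>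
    using that matrix_norm_sq[of m1 "B k \<omega>" m2] m1_pos
    unfolding V_eq F_gap[OF that(2)] Q_def D_def admissible_def by simp
  have step: "AE \<omega> in M. is_arg_min (prox_objective \<eta> h (B k \<omega>) (x k \<omega>) (v k \<omega>)) (\<lambda>_. True) (x (Suc k) \<omega>)" for k
    using update by eventually_elim (simp add: prox_objective_def[abs_def])
  have fin_Suc: "AE \<omega> in M. h (x (Suc k) \<omega>) \<noteq> \<infinity>" for k
    using step adm[of k] by eventually_elim (rule step_descent(1))
  have x0: "B 0 \<omega> = mat 1" "x 0 \<omega> = x0" "\<xi> 0 \<omega> = \<xi>0" if "\<omega> \<in> space M" for \<omega>
    using that initial_point xi_initial r_pos by (auto simp: metric qn_metric_def)
  have B_meas: "B k \<in> borel_measurable N"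
    if "\<And>j. j \<le> k \<Longrightarrow> x j \<in> borel_measurable N"
      "\<And>t. 1 \<le> t \<Longrightarrow> t \<le> k div r \<Longrightarrow> S t \<in> measurable N (count_space (Pow {1..n}))"
    for k and N :: "'w measure"
    unfolding metric[abs_def] using r_pos memory that
    by (intro borel_measurable_qn_metric[where n = n] smooth) auto
  have MB: "B k \<in> borel_measurable M" for k
    by (intro B_meas measurable_iterate measurable_sample)
  have Q_meas: "Q k \<in> borel_measurable M" for k
    unfolding Q_def[abs_def] using measurable_iterate MB
    by (intro borel_measurable_inner borel_measurable_matrix_vector_mult
        borel_measurable_diff borel_measurable_const)

  show ?thesis
  proof (intro allI impI ballI)
    fix k \<omega>0 assume \<omega>0: "\<omega>0 \<in> space M"
    let ?rate = "(?\<kappa> powr (1 / real r) * \<rho>) ^ k * inverse (?\<kappa> * \<rho> ^ r)"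
    have rate_pos: "0 < ?rate" using m1_pos m2_pos \<open>0 < \<rho>\<close> by simp
    show "enn2ereal (\<integral>\<^sup>+ \<omega>. e2ennreal (V k \<omega>) \<partial>M) \<le> ereal ?rate * V 0 \<omega>0"
    proof (cases "h x0 = \<infinity>")
      case True
      have "V 0 \<omega>0 = \<infinity>"
        using eta_pos True \<omega>0 unfolding V_eq F_eq h_xs by (simp add: x0)
      moreover have "ereal \<beta> * \<infinity> = \<infinity>" if "0 < \<beta>" for \<beta> using that by simp
      ultimately have "ereal ?rate * V 0 \<omega>0 = \<infinity>" using rate_pos by (simp only:)
      then show ?thesis by (simp only: ereal_less_eq(1))
    next
      case False
      have fin: "AE \<omega> in M. h (x k \<omega>) \<noteq> \<infinity>" for k
      proof (cases k)
        case 0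
        then show ?thesis using False x0(2) by (auto intro!: AE_I2)
      qed (use fin_Suc in simp)
      define v0 where "v0 = Q 0 \<omega>0 + A * \<eta>\<^sup>2 * \<xi>0 + 2 * \<eta> * gap x0"
      have adm0: "admissible (mat 1)"
      proof -
        obtain \<omega> where "\<omega> \<in> space M" "admissible (B 0 \<omega>)"
          using eventually_happens'[OF ae_filter_bot AE_conjI[OF AE_space adm[of 0]]] by blast
        then show ?thesis using x0 by simp
      qed
      have V0: "V 0 \<omega>0 = ereal v0"
        using V_real[of 0 \<omega>0] adm0 False x0[OF \<omega>0] by (simp add: v0_def D_def)
      have "0 \<le> \<xi>0"
      proof -
        obtain \<omega> where "\<omega> \<in> space M" "0 \<le> \<xi> 0 \<omega>"
          using eventually_happens'[OF ae_filter_bot AE_conjI[OF AE_space xi_nonneg[of 0]]] by blast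
        then show ?thesis using x0 by simp
      qed
      then have v0: "0 \<le> v0"
        using sqdist_bounds(3)[OF adm0, of x0] gap_nonneg[of x0] eta_pos \<open>0 < A\<close>
        unfolding v0_def Q_def by (simp add: x0[OF \<omega>0])
      \<comment> \<open>The expectation of the Lyapunov function as a real number, finite by the induction.\<close>
      define EV where "EV k = (\<integral>\<omega>. Q k \<omega> \<partial>M) + A * \<eta>\<^sup>2 * (\<integral>\<omega>. \<xi> k \<omega> \<partial>M) + 2 * \<eta> * (\<integral>\<omega>. D k \<omega> \<partial>M)" for k
      have main: "integrable M (Q k) \<and> integrable M (\<xi> k) \<and> integrable M (D k)
          \<and> EV k \<le> ?\<kappa> ^ (k div r) * \<rho> ^ k * v0" for k
      proof (induction k)
        case 0
        have c: "Q 0 \<omega> = Q 0 \<omega>0" "\<xi> 0 \<omega> = \<xi>0" "D 0 \<omega> = gap x0" if "\<omega> \<in> space M" for \<omega>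
          using that \<omega>0 x0 by (auto simp: Q_def D_def)
        have "integrable M (Q 0)" "integrable M (\<xi> 0)" "integrable M (D 0)"
          using c by (auto cong: Bochner_Integration.integrable_cong)
        moreover have "EV 0 = v0"
          unfolding EV_def v0_def using c
          by (simp add: prob_space cong: Bochner_Integration.integral_cong)
        ultimately show ?case by simp
      next
        case (Suc k)
        let ?N = "history_sub M P n r x \<phi> S k"
        let ?H = "history M P x \<phi> k"
        let ?e = "\<lambda>\<omega>. (norm (v k \<omega> - grad ?f (x k \<omega>)))\<^sup>2"
        have int: "integrable M (Q k)" "integrable M (\<xi> k)" "integrable M (D k)"
          and IH: "EV k \<le> ?\<kappa> ^ (k div r) * \<rho> ^ k * v0" using Suc by auto
        have H: "subalgebra M ?H" by (intro subalgebra_history measurable_iterate measurable_state)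
        note hist = measurable_iterate measurable_state measurable_sample
        have N: "subalgebra M ?N" by (intro subalgebra_history_sub hist)
        have grad_meas: "(\<lambda>\<omega>. grad ?f (x k \<omega>)) \<in> borel_measurable M"
          using continuous_grad measurable_iterate by (rule borel_measurable_continuous_on)
        have D_nonneg: "0 \<le> D k \<omega>" for k \<omega> unfolding D_def by (rule gap_nonneg)
        have var_nonneg: "AE \<omega> in M. 0 \<le> a * D k \<omega> + b * \<xi> k \<omega>"
          using xi_nonneg[of k] by eventually_elim (simp add: D_nonneg \<open>0 \<le> a\<close> \<open>0 \<le> b\<close>)
        have var_le: "AE \<omega> in M. enn2ereal (nn_cond_exp M ?H (\<lambda>\<omega>. ennreal (?e \<omega>)) \<omega>)
            \<le> ereal (a * D k \<omega> + b * \<xi> k \<omega>)"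
          using variance[of k] fin[of k] by eventually_elim (simp add: F_gap D_def)
        have var_int: "integrable M (\<lambda>\<omega>. a * D k \<omega> + b * \<xi> k \<omega>)"
          using int by (intro Bochner_Integration.integrable_add integrable_mult_right)
        have e_meas: "?e \<in> borel_measurable M" "AE \<omega> in M. 0 \<le> ?e \<omega>"
          using grad_meas measurable_gradient by auto
        note var = integral_le_of_cond_exp_le[OF H e_meas var_int var_nonneg var_le]
        have xi_bound_nonneg: "AE \<omega> in M. 0 \<le> (1 - \<gamma>) * \<xi> k \<omega> + c * D k \<omega>"
          using xi_nonneg[of k] by eventually_elim (simp add: D_nonneg \<open>\<gamma> \<le> 1\<close> \<open>0 \<le> c\<close>)
        have xi_le: "AE \<omega> in M. enn2ereal (nn_cond_exp M ?H (\<lambda>\<omega>. ennreal (\<xi> (Suc k) \<omega>)) \<omega>)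
            \<le> ereal ((1 - \<gamma>) * \<xi> k \<omega> + c * D k \<omega>)"
          using xi_recursion[of k] fin[of k] by eventually_elim (simp add: F_gap D_def)
        have xi_int: "integrable M (\<lambda>\<omega>. (1 - \<gamma>) * \<xi> k \<omega> + c * D k \<omega>)"
          using int by (intro Bochner_Integration.integrable_add integrable_mult_right)
        note xi = integral_le_of_cond_exp_le[OF H xi_measurable xi_nonneg xi_int xi_bound_nonneg xi_le]
        have mean: "AE \<omega> in M. vec_cond_exp M ?N (v k) \<omega> = grad ?f (x k \<omega>)"
          using sampling_independent[of k] unbiased[of k] by eventually_elim simp
        have NB: "B k \<in> borel_measurable ?N"
          by (intro B_meas iterate_history_sub sample_history_sub hist)
        have Nx: "x k \<in> borel_measurable ?N" by (intro iterate_history_sub hist order_refl)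
        let ?Q' = "\<lambda>\<omega>. sqdist (B k \<omega>) (x (Suc k) \<omega>)"
        note desc = expected_descent[OF prob_space_axioms N Nx NB measurable_gradient
            measurable_iterate adm step mean int(1)[unfolded Q_def[abs_def]] var(1)]
        have int_D: "integrable M (D (Suc k))" unfolding D_def[abs_def] by (rule desc(2))
        \<comment> \<open>\<open>j\<close> counts the metric changes between iterations \<open>k\<close> and \<open>Suc k\<close>.\<close>
        define j where "j = (if Suc k div r = k div r then 0 else 1 :: nat)"
        have div: "Suc k div r = k div r + j" unfolding j_def by (simp add: div_Suc)
        have kj: "1 \<le> ?\<kappa> ^ j" using kappa by (rule one_le_power)
        have change: "AE \<omega> in M. Q (Suc k) \<omega> \<le> ?\<kappa> ^ j * ?Q' \<omega>"
        proof (cases "Suc k div r = k div r")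
          case True
          have "k < r \<longleftrightarrow> Suc k < r"
            using True r_pos by (metis div_eq_0_iff less_not_refl)
          then have "B (Suc k) \<omega> = B k \<omega>" for \<omega> using True by (simp add: metric qn_metric_def)
          then show ?thesis using True by (simp add: Q_def j_def)
        next
          case False
          show ?thesis using adm[of k] adm[of "Suc k"]
          proof eventually_elim
            case (elim \<omega>)
            have "Q (Suc k) \<omega> \<le> m2 * (norm (x (Suc k) \<omega> - xs))\<^sup>2"
              unfolding Q_def by (rule sqdist_bounds(2)[OF elim(2)])
            also have "\<dots> = ?\<kappa> * (m1 * (norm (x (Suc k) \<omega> - xs))\<^sup>2)" using m1_pos by simp
            also have "\<dots> \<le> ?\<kappa> * ?Q' \<omega>"
              using kappa by (intro mult_left_mono sqdist_bounds(1)[OF elim(1)]) auto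
            finally show ?case using False by (simp add: j_def)
          qed
        qed
        have int_kQ': "integrable M (\<lambda>\<omega>. ?\<kappa> ^ j * ?Q' \<omega>)" using desc(1) by (rule integrable_mult_right)
        have int_Q: "integrable M (Q (Suc k))"
        proof (rule Bochner_Integration.integrable_bound[OF int_kQ' Q_meas])
          show "AE \<omega> in M. norm (Q (Suc k) \<omega>) \<le> norm (?\<kappa> ^ j * ?Q' \<omega>)"
            using change adm[of "Suc k"]
          proof eventually_elim
            case (elim \<omega>)
            then show ?case using sqdist_bounds(3)[OF elim(2), of "x (Suc k) \<omega>"] unfolding Q_def
              by (simp only: real_norm_def)
          qed
        qed
        have "(\<integral>\<omega>. Q (Suc k) \<omega> \<partial>M) \<le> (\<integral>\<omega>. ?\<kappa> ^ j * ?Q' \<omega> \<partial>M)"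
          by (rule integral_mono_AE[OF int_Q int_kQ' change])
        then have EQ: "(\<integral>\<omega>. Q (Suc k) \<omega> \<partial>M) \<le> ?\<kappa> ^ j * (\<integral>\<omega>. ?Q' \<omega> \<partial>M)" by simp
        define q where "q = (\<integral>\<omega>. Q k \<omega> \<partial>M)"
        define d where "d = (\<integral>\<omega>. D k \<omega> \<partial>M)"
        define z where "z = (\<integral>\<omega>. \<xi> k \<omega> \<partial>M)"
        have nonneg: "0 \<le> q" "0 \<le> d" "0 \<le> z"
          "0 \<le> (\<integral>\<omega>. \<xi> (Suc k) \<omega> \<partial>M)" "0 \<le> (\<integral>\<omega>. D (Suc k) \<omega> \<partial>M)"
        proof -
          show "0 \<le> q" unfolding q_def using adm[of k]
            by (intro integral_nonneg_AE) (auto elim!: eventually_mono simp: Q_def sqdist_bounds(3))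
        qed (use D_nonneg xi_nonneg in \<open>auto simp: d_def z_def intro!: integral_nonneg_AE\<close>)
        have var': "(\<integral>\<omega>. ?e \<omega> \<partial>M) \<le> a * d + b * z"
          using var(2) int unfolding d_def z_def by simp
        have xi': "(\<integral>\<omega>. \<xi> (Suc k) \<omega> \<partial>M) \<le> (1 - \<gamma>) * z + c * d"
          using xi(2) int unfolding d_def z_def by simp
        let ?T = "(\<integral>\<omega>. ?Q' \<omega> \<partial>M) + A * \<eta>\<^sup>2 * (\<integral>\<omega>. \<xi> (Suc k) \<omega> \<partial>M) + 2 * \<eta> * (\<integral>\<omega>. D (Suc k) \<omega> \<partial>M)"
        have descent: "(\<integral>\<omega>. ?Q' \<omega> \<partial>M) + 2 * \<eta> * (\<integral>\<omega>. D (Suc k) \<omega> \<partial>M)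
            \<le> (1 - \<eta> * \<mu> / m2) * q + 2 * \<eta>\<^sup>2 / m1 * (\<integral>\<omega>. ?e \<omega> \<partial>M)"
          unfolding q_def Q_def D_def by (rule desc(3))
        have rho: "1 - \<eta> * \<mu> / m2 \<le> \<rho>" "2 * m2 * b / (m1\<^sup>2 * A) + 1 - \<gamma> \<le> \<rho>"
          unfolding rho_eq by simp_all
        have one: "?T \<le> \<rho> * EV k"
          using lyapunov_contraction[OF descent var' xi' nonneg(1-3) \<open>0 \<le> a\<close> \<open>0 \<le> b\<close> eta_pos
              \<open>0 < A\<close> m1_pos \<open>m1 \<le> m2\<close> rho \<open>(2 * m2 * a / m1\<^sup>2 + A * c) * \<eta> \<le> 2 * \<rho>\<close>]
          unfolding EV_def q_def d_def z_def .
        have "EV (Suc k) \<le> ?\<kappa> ^ j * ?T"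
        proof -
          let ?R = "A * \<eta>\<^sup>2 * (\<integral>\<omega>. \<xi> (Suc k) \<omega> \<partial>M) + 2 * \<eta> * (\<integral>\<omega>. D (Suc k) \<omega> \<partial>M)"
          have "0 \<le> ?R" using nonneg eta_pos \<open>0 < A\<close> by simp
          then have "1 * ?R \<le> ?\<kappa> ^ j * ?R" using kj by (rule mult_right_mono[rotated])
          then show ?thesis using EQ unfolding EV_def by (simp only: distrib_left)
        qed
        also have "\<dots> \<le> ?\<kappa> ^ j * (\<rho> * EV k)" using one kj by (intro mult_left_mono) auto
        also have "\<dots> \<le> ?\<kappa> ^ j * (\<rho> * (?\<kappa> ^ (k div r) * \<rho> ^ k * v0))"
          using IH kj \<open>0 < \<rho>\<close> by (intro mult_left_mono) auto
        also have "\<dots> = ?\<kappa> ^ (Suc k div r) * \<rho> ^ Suc k * v0"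
          unfolding div power_add by simp
        finally show ?case using int_Q xi(1) int_D by blast
      qed
      have VW: "AE \<omega> in M. e2ennreal (V k \<omega>) = ennreal (Q k \<omega> + A * \<eta>\<^sup>2 * \<xi> k \<omega> + 2 * \<eta> * D k \<omega>)
          \<and> 0 \<le> Q k \<omega> + A * \<eta>\<^sup>2 * \<xi> k \<omega> + 2 * \<eta> * D k \<omega>"
        using adm[of k] fin[of k] xi_nonneg[of k]
      proof eventually_elim
        case (elim \<omega>)
        have "0 \<le> Q k \<omega>" "0 \<le> D k \<omega>"
          unfolding Q_def D_def by (rule sqdist_bounds(3)[OF elim(1)], rule gap_nonneg)
        with elim(3) have "0 \<le> Q k \<omega> + A * \<eta>\<^sup>2 * \<xi> k \<omega> + 2 * \<eta> * D k \<omega>"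
          using eta_pos \<open>0 < A\<close> by simp
        then show ?case unfolding V_real[OF elim(1,2)] by (simp only: e2ennreal_ereal simp_thms)
      qed
      have "(\<integral>\<^sup>+ \<omega>. e2ennreal (V k \<omega>) \<partial>M) = (\<integral>\<^sup>+ \<omega>. ennreal (Q k \<omega> + A * \<eta>\<^sup>2 * \<xi> k \<omega> + 2 * \<eta> * D k \<omega>) \<partial>M)"
        using VW by (intro nn_integral_cong_AE) (auto elim: eventually_mono)
      also have "\<dots> = ennreal (EV k)"
      proof (subst nn_integral_eq_integral)
        show "integrable M (\<lambda>\<omega>. Q k \<omega> + A * \<eta>\<^sup>2 * \<xi> k \<omega> + 2 * \<eta> * D k \<omega>)"
          using main[of k] by (intro Bochner_Integration.integrable_add integrable_mult_right) auto
        show "AE \<omega> in M. 0 \<le> Q k \<omega> + A * \<eta>\<^sup>2 * \<xi> k \<omega> + 2 * \<eta> * D k \<omega>"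
          using VW by (auto elim: eventually_mono)
        show "ennreal (\<integral>\<omega>. Q k \<omega> + A * \<eta>\<^sup>2 * \<xi> k \<omega> + 2 * \<eta> * D k \<omega> \<partial>M) = ennreal (EV k)"
          using main[of k] unfolding EV_def by simp
      qed
      also have "\<dots> \<le> ennreal (?\<kappa> ^ (k div r) * \<rho> ^ k * v0)" using main[of k] by (intro ennreal_leI) blast
      also have "\<dots> \<le> ennreal (?rate * v0)"
        using geometric_rate_bound[OF kappa \<open>0 < \<rho>\<close> r_pos, of k] v0
          \<open>(m2 / m1) powr (1 / real r) * \<rho> < 1\<close>
        by (intro ennreal_leI mult_right_mono) auto
      finally have "enn2ereal (\<integral>\<^sup>+ \<omega>. e2ennreal (V k \<omega>) \<partial>M) \<le> enn2ereal (ennreal (?rate * v0))"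
        by (simp add: less_eq_ennreal.rep_eq)
      also have "\<dots> = ereal ?rate * V 0 \<omega>0"
        using enn2ereal_ennreal[OF mult_nonneg_nonneg[OF less_imp_le[OF rate_pos] v0]]
        unfolding V0 by (simp only: times_ereal.simps)
      finally show ?thesis .
    qed
  qed
qed

end
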